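(* Let $T$ be a reduced ring which is integral over its center $C(T)$, and assume $C(T)$ is a Hilbert ring. Then either $T$ has a maximal subring, or $T$ is a commutative Hilbert ring with $|T|\leq 2^{2^{\aleph_0}}$. Moreover, if $C(T)$ is zero-dimensional and $T$ has no maximal subring, then $T$ is a commutative von Neumann regular ring.
   Context: All rings are associative with identity $1\neq0$; subrings contain the identity. A maximal subring of $T$ is a proper subring with no subring strictly between it and $T$. A ring is reduced if it has no nonzero nilpotent elements. $T$ is integral over its center if every element of $T$ is a root of a monic polynomial with coefficients in $C(T)$. A commutative ring is Hilbert if every prime ideal is an intersection of maximal ideals. A ring is zero-dimensional if its classical Krull dimension is $0$, i.e., every prime ideal is maximal. *)

theory Defs
  imports Main
begin

definition is_subring :: "'a::ring_1 set \<Rightarrow> bool" where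
  "is_subring S \<longleftrightarrow> 1 \<in> S \<and> (\<forall>x\<in>S. \<forall>y\<in>S. x + y \<in> S \<and> x * y \<in> S) \<and> (\<forall>x\<in>S. - x \<in> S)"

definition is_maximal_subring :: "'a::ring_1 set \<Rightarrow> bool" where
  "is_maximal_subring S \<longleftrightarrow> is_subring S \<and> S \<noteq> UNIV \<and>
     (\<forall>R. is_subring R \<and> S \<subseteq> R \<longrightarrow> R = S \<or> R = UNIV)"

definition has_maximal_subring :: "'a::ring_1 itself \<Rightarrow> bool" where
  "has_maximal_subring _ \<longleftrightarrow> (\<exists>S::'a set. is_maximal_subring S)"

definition center :: "'a::ring_1 set" where
  "center = {c. \<forall>x. c * x = x * c}"

definition reduced_ring :: "'a::ring_1 itself \<Rightarrow> bool" where
  "reduced_ring _ \<longleftrightarrow> (\<forall>(x::'a) (n::nat). x ^ n = 0 \<longrightarrow> x = 0)"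

definition commutative_ring :: "'a::ring_1 itself \<Rightarrow> bool" where
  "commutative_ring _ \<longleftrightarrow> (\<forall>x y::'a. x * y = y * x)"

definition integral_over :: "'a::ring_1 set \<Rightarrow> bool" where
  "integral_over S \<longleftrightarrow> (\<forall>x. \<exists>(n::nat) c. (\<forall>i<n. c i \<in> S) \<and> x ^ n + (\<Sum>i<n. c i * x ^ i) = 0)"

text \<open>Ideal theory of a commutative subring S (given as a carrier set).\<close>
definition ideal_in :: "'a::ring_1 set \<Rightarrow> 'a set \<Rightarrow> bool" where
  "ideal_in S I \<longleftrightarrow> I \<subseteq> S \<and> 0 \<in> I \<and> (\<forall>x\<in>I. \<forall>y\<in>I. x + y \<in> I) \<and> (\<forall>x\<in>I. - x \<in> I)
     \<and> (\<forall>s\<in>S. \<forall>x\<in>I. s * x \<in> I \<and> x * s \<in> I)"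

definition prime_ideal_in :: "'a::ring_1 set \<Rightarrow> 'a set \<Rightarrow> bool" where
  "prime_ideal_in S P \<longleftrightarrow> ideal_in S P \<and> P \<noteq> S \<and>
     (\<forall>a\<in>S. \<forall>b\<in>S. a * b \<in> P \<longrightarrow> a \<in> P \<or> b \<in> P)"

definition maximal_ideal_in :: "'a::ring_1 set \<Rightarrow> 'a set \<Rightarrow> bool" where
  "maximal_ideal_in S M \<longleftrightarrow> ideal_in S M \<and> M \<noteq> S \<and>
     (\<forall>J. ideal_in S J \<and> M \<subseteq> J \<longrightarrow> J = M \<or> J = S)"

definition hilbert_on :: "'a::ring_1 set \<Rightarrow> bool" where
  "hilbert_on S \<longleftrightarrow> (\<forall>P. prime_ideal_in S P \<longrightarrow>
     P = \<Inter>{M. maximal_ideal_in S M \<and> P \<subseteq> M})"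

definition zero_dimensional_on :: "'a::ring_1 set \<Rightarrow> bool" where
  "zero_dimensional_on S \<longleftrightarrow> (\<forall>P. prime_ideal_in S P \<longrightarrow> maximal_ideal_in S P)"

definition von_neumann_regular :: "'a::ring_1 itself \<Rightarrow> bool" where
  "von_neumann_regular _ \<longleftrightarrow> (\<forall>a::'a. \<exists>x. a * x * a = a)"

end

theory Submission
  imports Defs "HOL-Computational_Algebra.Polynomial" "HOL-Library.Countable_Set" "HOL-Library.Nat_Bijection"
begin

text \<open>Suppose \<open>T\<close> has no maximal subring; the same then holds for all its quotients. Every
  \<open>c \<noteq> 0\<close> lies outside some completely prime ideal \<open>P\<close>. Modulo \<open>P\<close> the constant term of an integral
  equation of \<open>c\<close> may be taken nonzero, so the Hilbert property yields a maximal ideal of the center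
  avoiding it, and lying over holds because the coefficients are central: hence \<open>c\<close> lies outside some
  maximal ideal of \<open>T\<close>. It thus suffices to look at simple quotients.

  A simple ring with a nontrivial idempotent has block triangular maximal subrings; without one,
  integrality over the center makes it a division ring. There the centralizer of a noncentral
  element \<open>a\<close> has finite index, bounded by the degree of \<open>a\<close>, so the ring is finitely generated over a
  proper subring and Zorn's lemma gives a maximal one. Hence \<open>T\<close> is commutative.

  The residue fields are countable: an uncountable field has an element \<open>t\<close> that is transcendental
  over a subfield \<open>F\<close>, with everything algebraic over \<open>F(t)\<close>, and a subring maximal among those
  containing \<open>F[t]\<close> but not \<open>1/t\<close> is a valuation ring and a maximal subring. Distinct maximal ideals
  have nonisomorphic residue fields, for otherwise the graph of an isomorphism yields a maximal
  subring. So there are at most \<open>2\<close> to the \<open>\<aleph>\<^sub>0\<close> maximal ideals, and \<open>T\<close> embeds in the product of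
  their residue fields.\<close>

section \<open>Subrings, ideals and Zorn's lemma\<close>

lemma is_subringD:
  assumes "is_subring S"
  shows "1 \<in> S" "x \<in> S \<Longrightarrow> y \<in> S \<Longrightarrow> x + y \<in> S" "x \<in> S \<Longrightarrow> y \<in> S \<Longrightarrow> x * y \<in> S"
    "x \<in> S \<Longrightarrow> - x \<in> S" "0 \<in> S" "x \<in> S \<Longrightarrow> y \<in> S \<Longrightarrow> x - y \<in> S"
proof -
  show *: "1 \<in> S" "x \<in> S \<Longrightarrow> y \<in> S \<Longrightarrow> x + y \<in> S" "x \<in> S \<Longrightarrow> y \<in> S \<Longrightarrow> x * y \<in> S"
    "x \<in> S \<Longrightarrow> - x \<in> S" for x y
    using assms by (auto simp: is_subring_def)
  have "1 + - 1 \<in> S"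
    using * by blast
  then show "0 \<in> S"
    by simp
  show "x - y \<in> S" if "x \<in> S" "y \<in> S"
    using *(2)[OF that(1) *(4)[OF that(2)]] by simp
qed

lemma is_subring_sum: "is_subring S \<Longrightarrow> (\<And>i. i \<in> I \<Longrightarrow> f i \<in> S) \<Longrightarrow> sum f I \<in> S"
  by (induction I rule: infinite_finite_induct) (auto simp: is_subringD)

lemma is_subring_power: "is_subring S \<Longrightarrow> x \<in> S \<Longrightarrow> x ^ n \<in> S"
  by (induction n) (auto simp: is_subringD)

lemma is_subring_center: "is_subring (center :: 'a::ring_1 set)"
  unfolding is_subring_def
proof (intro conjI ballI)
  fix x y :: 'a assume "x \<in> center" "y \<in> center"
  then have x: "x * z = z * x" and y: "y * z = z * y" for z
    by (simp_all only: center_def mem_Collect_eq)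
  show "x + y \<in> center"
    by (simp only: center_def mem_Collect_eq distrib_left distrib_right x y simp_thms)
  have "x * y * z = z * (x * y)" for z
    by (metis x y mult.assoc)
  then show "x * y \<in> center"
    by (simp only: center_def mem_Collect_eq simp_thms)
qed (simp_all add: center_def)

lemma centerD: "c \<in> center \<Longrightarrow> c * x = x * c"
  by (simp add: center_def)

lemma ideal_inD:
  assumes "ideal_in S I"
  shows "I \<subseteq> S" "0 \<in> I" "x \<in> I \<Longrightarrow> y \<in> I \<Longrightarrow> x + y \<in> I" "x \<in> I \<Longrightarrow> - x \<in> I"
    "x \<in> I \<Longrightarrow> y \<in> I \<Longrightarrow> x - y \<in> I"
    "s \<in> S \<Longrightarrow> x \<in> I \<Longrightarrow> s * x \<in> I" "s \<in> S \<Longrightarrow> x \<in> I \<Longrightarrow> x * s \<in> I"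
proof -
  show *: "I \<subseteq> S" "0 \<in> I" "x \<in> I \<Longrightarrow> y \<in> I \<Longrightarrow> x + y \<in> I" "x \<in> I \<Longrightarrow> - x \<in> I"
    "s \<in> S \<Longrightarrow> x \<in> I \<Longrightarrow> s * x \<in> I" "s \<in> S \<Longrightarrow> x \<in> I \<Longrightarrow> x * s \<in> I" for x y s
    using assms by (auto simp: ideal_in_def)
  show "x - y \<in> I" if "x \<in> I" "y \<in> I"
    using *(3)[OF that(1) *(4)[OF that(2)]] by simp
qed

lemma ideal_in_sum: "ideal_in S I \<Longrightarrow> (\<And>i. i \<in> J \<Longrightarrow> f i \<in> I) \<Longrightarrow> sum f J \<in> I"
  by (induction J rule: infinite_finite_induct) (auto simp: ideal_inD)

lemma ideal_in_add_left_iff: "ideal_in S I \<Longrightarrow> x \<in> I \<Longrightarrow> x + y \<in> I \<longleftrightarrow> y \<in> I"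
  by (metis add_diff_cancel_left' ideal_inD(3,5))

lemma ideal_in_UNIV_eq:
  assumes "ideal_in UNIV I" "1 \<in> I"
  shows "I = UNIV"
  using ideal_inD(6)[OF assms(1) UNIV_I assms(2)] by auto

text \<open>Two-sided ideals with reduced quotient. Squares suffice: a nonzero nilpotent has a
  nonzero power whose square is zero.\<close>

definition reduced_ideal :: "'a::ring_1 set \<Rightarrow> bool" where
  "reduced_ideal I \<longleftrightarrow> ideal_in UNIV I \<and> (\<forall>x. x * x \<in> I \<longrightarrow> x \<in> I)"

lemma chain_Union_pair:
  "subset.chain \<A> \<C> \<Longrightarrow> x \<in> \<Union>\<C> \<Longrightarrow> y \<in> \<Union>\<C> \<Longrightarrow> \<exists>R\<in>\<C>. x \<in> R \<and> y \<in> R"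
  unfolding subset_chain_def by (elim UnionE conjE) (meson in_mono)

lemma is_subring_Union_chain:
  assumes "\<C> \<noteq> {}" "subset.chain {R. is_subring R} \<C>"
  shows "is_subring (\<Union>\<C>)"
proof -
  have sub: "is_subring R" if "R \<in> \<C>" for R
    using assms(2) that by (auto simp: subset_chain_def)
  have "x + y \<in> \<Union>\<C> \<and> x * y \<in> \<Union>\<C>" if xy: "x \<in> \<Union>\<C>" "y \<in> \<Union>\<C>" for x y
  proof -
    obtain R where "R \<in> \<C>" "x \<in> R" "y \<in> R"
      using chain_Union_pair[OF assms(2) xy] by blast
    then show ?thesis
      using sub[of R] is_subringD(2,3) by blast
  qed
  moreover have "- x \<in> \<Union>\<C>" if "x \<in> \<Union>\<C>" for x
    using that sub is_subringD(4) by blast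
  moreover have "1 \<in> \<Union>\<C>"
    using assms(1) sub is_subringD(1) by blast
  ultimately show ?thesis
    unfolding is_subring_def by blast
qed

lemma ideal_in_Union_chain:
  assumes "\<C> \<noteq> {}" "subset.chain {I. ideal_in S I} \<C>"
  shows "ideal_in S (\<Union>\<C>)"
proof -
  have sub: "ideal_in S I" if "I \<in> \<C>" for I
    using assms(2) that by (auto simp: subset_chain_def)
  have "x + y \<in> \<Union>\<C>" if xy: "x \<in> \<Union>\<C>" "y \<in> \<Union>\<C>" for x y
  proof -
    obtain I where "I \<in> \<C>" "x \<in> I" "y \<in> I"
      using chain_Union_pair[OF assms(2) xy] by blast
    then show ?thesis
      using sub[of I] ideal_inD(3) by blast
  qed
  moreover have "s * x \<in> \<Union>\<C>" "x * s \<in> \<Union>\<C>"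
    if "x \<in> \<Union>\<C>" "s \<in> S" for x s
    using that sub ideal_inD(6,7) by blast+
  moreover have "- x \<in> \<Union>\<C>" if "x \<in> \<Union>\<C>" for x
    using that sub ideal_inD(4) by blast
  moreover have "0 \<in> \<Union>\<C>"
    using assms(1) sub ideal_inD(2) by blast
  moreover have "\<Union>\<C> \<subseteq> S"
    using sub ideal_inD(1) by blast
  ultimately show ?thesis
    unfolding ideal_in_def by blast
qed

lemma reduced_ideal_Union_chain:
  assumes "\<C> \<noteq> {}" "subset.chain {I. reduced_ideal I} \<C>"
  shows "reduced_ideal (\<Union>\<C>)"
proof -
  have "subset.chain {I. ideal_in UNIV I} \<C>"
    using assms(2) by (auto simp: subset_chain_def reduced_ideal_def)
  moreover have "reduced_ideal I" if "I \<in> \<C>" for I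
    using assms(2) that by (auto simp: subset_chain_def)
  ultimately show ?thesis
    using ideal_in_Union_chain[OF assms(1)] unfolding reduced_ideal_def by blast
qed

text \<open>A finite set inside the union of a chain already lies in one member, so the property of
  containing no set of \<open>\<X>\<close> survives unions of chains. In the applications
  \<open>\<X>\<close> consists of singletons, of a finite generating set, or of coefficient sets of
  polynomials.\<close>

lemma Zorn_avoiding:
  assumes chains: "\<And>\<C>. \<C> \<noteq> {} \<Longrightarrow> subset.chain {A. P A} \<C> \<Longrightarrow> P (\<Union>\<C>)"
    and fin: "\<And>X. X \<in> \<X> \<Longrightarrow> finite X"
    and S: "P S" "\<And>X. X \<in> \<X> \<Longrightarrow> \<not> X \<subseteq> S"
  obtains M where "P M" "S \<subseteq> M" "\<forall>X\<in>\<X>. \<not> X \<subseteq> M"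
    "\<forall>N. P N \<and> M \<subset> N \<longrightarrow> (\<exists>X\<in>\<X>. X \<subseteq> N)"
proof -
  let ?A = "{A. P A \<and> S \<subseteq> A \<and> (\<forall>X\<in>\<X>. \<not> X \<subseteq> A)}"
  have "\<exists>M\<in>?A. \<forall>N\<in>?A. M \<subseteq> N \<longrightarrow> N = M"
  proof (rule subset_Zorn_nonempty)
    show "?A \<noteq> {}"
      using S by blast
    fix \<C> assume ne: "\<C> \<noteq> {}" and ch: "subset.chain ?A \<C>"
    have "P (\<Union>\<C>)"
      using ne ch by (intro chains) (auto simp: subset_chain_def)
    moreover have "S \<subseteq> \<Union>\<C>"
      using ne ch by (fastforce simp: subset_chain_def)
    moreover have "\<not> X \<subseteq> \<Union>\<C>" if X: "X \<in> \<X>" for X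
    proof
      assume "X \<subseteq> \<Union>\<C>"
      then obtain A where "A \<in> \<C>" "X \<subseteq> A"
        using finite_subset_Union_chain[OF fin[OF X] _ ne ch] by blast
      then show False
        using ch X by (auto simp: subset_chain_def)
    qed
    ultimately show "\<Union>\<C> \<in> ?A"
      by blast
  qed
  then obtain M where M: "M \<in> ?A" and max: "\<forall>N\<in>?A. M \<subseteq> N \<longrightarrow> N = M"
    by (rule bexE)
  show thesis
  proof (rule that)
    show "P M" "S \<subseteq> M"
      using M by simp_all
    show "\<forall>X\<in>\<X>. \<not> X \<subseteq> M"
      using M by simp
    show "\<forall>N. P N \<and> M \<subset> N \<longrightarrow> (\<exists>X\<in>\<X>. X \<subseteq> N)"
    proof (intro allI impI)
      fix N assume N: "P N \<and> M \<subset> N"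
      then have "N \<notin> ?A"
        using max by blast
      then show "\<exists>X\<in>\<X>. X \<subseteq> N"
        using M N by auto
    qed
  qed
qed

section \<open>Maximal subrings\<close>

lemma has_maximal_subringI: "is_maximal_subring (S :: 'a::ring_1 set) \<Longrightarrow> has_maximal_subring TYPE('a)"
  by (auto simp: has_maximal_subring_def)

text \<open>Zorn's lemma yields a subring maximal among those that contain \<open>S\<close> but not
  all of \<open>X\<close>; any larger subring contains \<open>S\<close> and \<open>X\<close>, hence
  everything.\<close>

lemma maximal_subring_finitely_generated:
  fixes S :: "'a::ring_1 set"
  assumes "is_subring S" "S \<noteq> UNIV" "finite X"
    and gen: "\<And>R. is_subring R \<Longrightarrow> S \<subseteq> R \<Longrightarrow> X \<subseteq> R \<Longrightarrow> R = UNIV"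
  shows "has_maximal_subring TYPE('a)"
proof -
  have av: "\<not> Y \<subseteq> S" if "Y \<in> {X}" for Y
    using gen[of S] assms(1,2) that by blast
  have fin: "finite Y" if "Y \<in> {X}" for Y
    using that assms(3) by simp
  obtain M where M: "is_subring M" "S \<subseteq> M" "\<forall>Y\<in>{X}. \<not> Y \<subseteq> M"
    "\<forall>N. is_subring N \<and> M \<subset> N \<longrightarrow> (\<exists>Y\<in>{X}. Y \<subseteq> N)"
    by (rule Zorn_avoiding[where P = is_subring, OF _ fin assms(1) av]) (rule is_subring_Union_chain)
  have M4: "N = UNIV" if "is_subring N" "M \<subseteq> N" "N \<noteq> M" for N
    using gen[OF that(1)] M(2,4) that by blast
  have "M \<noteq> UNIV"
    using M(3) by auto
  have "is_maximal_subring M"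
    unfolding is_maximal_subring_def using M(1) M4 \<open>M \<noteq> UNIV\<close> by metis
  then show ?thesis
    by (rule has_maximal_subringI)
qed

text \<open>A subring above the preimage of \<open>S\<close> contains the kernel of
  \<open>f\<close>, as \<open>0 \<in> S\<close>, and is therefore the full preimage of its
  image.\<close>

lemma maximal_subring_vimage:
  fixes f :: "'a::ring_1 \<Rightarrow> 'b::ring_1"
  assumes add: "\<And>x y. f (x + y) = f x + f y" and mult: "\<And>x y. f (x * y) = f x * f y"
    and one: "f 1 = 1" and "surj f" and "has_maximal_subring TYPE('b)"
  shows "has_maximal_subring TYPE('a)"
proof -
  obtain S :: "'b set" where S: "is_subring S" "S \<noteq> UNIV"
    "\<And>R. is_subring R \<Longrightarrow> S \<subseteq> R \<Longrightarrow> R = S \<or> R = UNIV"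
    using assms(5) by (auto simp: has_maximal_subring_def is_maximal_subring_def)
  have zero: "f 0 = 0"
    using add[of 0 0] by simp
  have minus: "f (- x) = - f x" for x
    using add[of x "- x"] zero by (simp add: eq_neg_iff_add_eq_0 add.commute)
  have "is_maximal_subring (f -` S)"
    unfolding is_maximal_subring_def
  proof (intro conjI allI impI)
    show "is_subring (f -` S)"
      using S(1) by (auto simp: is_subring_def add mult one minus)
    show "f -` S \<noteq> UNIV"
      using S(2) \<open>surj f\<close> by (metis surj_image_vimage_eq)
    fix R assume R: "is_subring R \<and> f -` S \<subseteq> R"
    have "is_subring (f ` R)"
      unfolding is_subring_def
    proof (intro conjI ballI)
      note R' = is_subringD[OF conjunct1[OF R]]
      show "1 \<in> f ` R"
        using R'(1) one[symmetric] by (rule rev_image_eqI)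
      show "- x \<in> f ` R" if "x \<in> f ` R" for x
        using that by (auto simp flip: minus intro!: imageI R'(4))
      show "x + y \<in> f ` R" "x * y \<in> f ` R" if "x \<in> f ` R" "y \<in> f ` R" for x y
        using that by (auto simp flip: add mult intro!: imageI R'(2,3))
    qed
    moreover have "S \<subseteq> f ` R"
      using R \<open>surj f\<close> by (metis image_mono surj_image_vimage_eq)
    ultimately have "f ` R = S \<or> f ` R = UNIV"
      using S(3) by blast
    moreover have "x \<in> R" if "f x \<in> f ` R" for x
    proof -
      obtain r where r: "r \<in> R" "f x = f r"
        using \<open>f x \<in> f ` R\<close> by auto
      then have "f (x - r) \<in> S"
        using add[of x "- r"] minus[of r] is_subringD(5)[OF S(1)] by simp
      then have "x - r \<in> R"
        using R by blast
      then show ?thesis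
        using is_subringD(2)[of R "x - r" r] R r by simp
    qed
    ultimately show "R = f -` S \<or> R = UNIV"
      by blast
  qed
  then show ?thesis
    by (rule has_maximal_subringI)
qed

section \<open>Completely prime ideals of reduced rings\<close>

text \<open>The square of \<open>b * a\<close> is \<open>b * (a * b) * a\<close>.\<close>

lemma reduced_ideal_commute:
  assumes "reduced_ideal I" "a * b \<in> I"
  shows "b * a \<in> I"
proof -
  have I: "ideal_in UNIV I"
    using assms(1) by (simp add: reduced_ideal_def)
  have "b * (a * b) * a \<in> I"
    by (intro ideal_inD(7)[OF I UNIV_I ideal_inD(6)[OF I UNIV_I]] assms(2))
  then have "(b * a) * (b * a) \<in> I"
    by (simp add: mult.assoc)
  then show ?thesis
    using assms(1) unfolding reduced_ideal_def by blast
qed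

text \<open>The square of \<open>a * r * b\<close> has the factor \<open>b * a\<close>, which lies
  in \<open>I\<close> by \<open>reduced_ideal_commute\<close>.\<close>

lemma reduced_ideal_insert:
  assumes "reduced_ideal I" "a * b \<in> I"
  shows "a * r * b \<in> I"
proof -
  have I: "ideal_in UNIV I"
    using assms(1) by (simp add: reduced_ideal_def)
  have "a * r * (b * a) * (r * b) \<in> I"
    by (intro ideal_inD(7)[OF I UNIV_I ideal_inD(6)[OF I UNIV_I]] reduced_ideal_commute[OF assms])
  then have "(a * r * b) * (a * r * b) \<in> I"
    by (simp add: mult.assoc)
  then show ?thesis
    using assms(1) unfolding reduced_ideal_def by blast
qed

text \<open>\<open>reduced_ideal_insert\<close> makes the annihilator of \<open>a\<close> modulo
  \<open>I\<close> two-sided, and it also turns \<open>x * x * a \<in> I\<close> into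
  \<open>(x * a) * (x * a) \<in> I\<close>.\<close>

lemma reduced_ideal_annihilator:
  assumes "reduced_ideal I"
  shows "reduced_ideal {x. x * a \<in> I}" "I \<subseteq> {x. x * a \<in> I}"
proof -
  have I: "ideal_in UNIV I" and red: "\<And>x. x * x \<in> I \<Longrightarrow> x \<in> I"
    using assms unfolding reduced_ideal_def by blast+
  show "I \<subseteq> {x. x * a \<in> I}"
    using ideal_inD(7)[OF I] by auto
  have "ideal_in UNIV {x. x * a \<in> I}"
    unfolding ideal_in_def mem_Collect_eq distrib_right mult_zero_left mult_minus_left
  proof (intro conjI ballI)
    fix s x assume x: "x \<in> {x. x * a \<in> I}"
    then show "s * x * a \<in> I"
      using ideal_inD(6)[OF I UNIV_I, of "x * a" s] by (simp add: mult.assoc)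
    show "x * s * a \<in> I"
      using x reduced_ideal_insert[OF assms] by simp
  qed (use ideal_inD(2-4)[OF I] in auto)
  moreover have "x * a \<in> I" if "x * x * a \<in> I" for x
    using reduced_ideal_insert[OF assms, of x "x * a" a] red[of "x * a"] that
    by (simp add: mult.assoc)
  ultimately show "reduced_ideal {x. x * a \<in> I}"
    unfolding reduced_ideal_def mem_Collect_eq by (intro conjI allI impI)
qed

lemma reduced_ideal_zero:
  assumes "reduced_ring TYPE('a::ring_1)"
  shows "reduced_ideal {0 :: 'a}"
proof -
  have "x = 0" if "x * x = 0" for x :: 'a
  proof -
    have "x ^ 2 = 0 \<longrightarrow> x = 0"
      using assms unfolding reduced_ring_def by blast
    then show ?thesis
      using that by (simp add: power2_eq_square)
  qed
  moreover have "ideal_in UNIV {0 :: 'a}"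
    by (simp add: ideal_in_def)
  ultimately show ?thesis
    unfolding reduced_ideal_def singleton_iff by blast
qed

text \<open>A reduced ideal maximal among those disjoint from \<open>X\<close> is completely prime: if \<open>a * b\<close>
  lies in it but neither factor does, the annihilator of \<open>a\<close> modulo the ideal is larger, hence
  contains some \<open>x \<in> X\<close>; the annihilator of \<open>x\<close> is then larger as well and meets \<open>X\<close>.\<close>

lemma completely_prime_avoiding:
  fixes X :: "'a::ring_1 set"
  assumes "reduced_ring TYPE('a)" "0 \<notin> X" "X \<noteq> {}"
    and X: "\<And>I x y. reduced_ideal I \<Longrightarrow> x \<in> X \<Longrightarrow> y \<in> X \<Longrightarrow> x * y \<in> I \<Longrightarrow> X \<inter> I \<noteq> {}"
  obtains P where "prime_ideal_in UNIV P" "P \<inter> X = {}"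
proof -
  have av: "\<not> Y \<subseteq> {0}" and fin: "finite Y" if "Y \<in> (\<lambda>x. {x}) ` X" for Y
    using assms(2) that by auto
  obtain P where P: "reduced_ideal P" "{0} \<subseteq> P"
    and avoid: "\<forall>Y\<in>(\<lambda>x. {x}) ` X. \<not> Y \<subseteq> P"
    and max: "\<forall>N. reduced_ideal N \<and> P \<subset> N \<longrightarrow> (\<exists>Y\<in>(\<lambda>x. {x}) ` X. Y \<subseteq> N)"
    by (rule Zorn_avoiding[where P = reduced_ideal, OF _ fin reduced_ideal_zero[OF assms(1)] av])
      (rule reduced_ideal_Union_chain)
  note P = P(1)
  have I: "ideal_in UNIV P"
    using P by (simp add: reduced_ideal_def)
  have ann: "\<exists>x\<in>X. x * a \<in> P" if "b * a \<in> P" "b \<notin> P" for a b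
    using max[rule_format, of "{x. x * a \<in> P}"] reduced_ideal_annihilator[OF P, of a] that
    by auto
  have "a \<in> P \<or> b \<in> P" if ab: "a * b \<in> P" for a b
  proof (rule ccontr)
    assume *: "\<not> (a \<in> P \<or> b \<in> P)"
    then obtain x where x: "x \<in> X" "x * b \<in> P"
      using ann[OF ab] by blast
    then obtain y where "y \<in> X" "y * x \<in> P"
      using ann[OF reduced_ideal_commute[OF P x(2)]] * by blast
    then show False
      using X[OF P _ x(1)] avoid by auto
  qed
  moreover have "P \<inter> X = {}"
    using avoid by auto
  moreover have "P \<noteq> UNIV"
    using \<open>P \<inter> X = {}\<close> \<open>X \<noteq> {}\<close> by auto
  ultimately show thesis
    using that I unfolding prime_ideal_in_def by blast
qed

section \<open>Maximal ideals missing a given element\<close>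

text \<open>The ideal \<open>m + sC\<close> of \<open>C\<close> is strictly larger than
  \<open>m\<close>, so it contains \<open>1\<close>.\<close>

lemma maximal_ideal_in_inverse:
  fixes C :: "'a::ring_1 set"
  assumes C: "is_subring C" and comm: "\<And>x y. x \<in> C \<Longrightarrow> y \<in> C \<Longrightarrow> x * y = y * x"
    and m: "maximal_ideal_in C m" and s: "s \<in> C" "s \<notin> m"
  obtains r where "r \<in> C" "1 - s * r \<in> m"
proof -
  have I: "ideal_in C m"
    using m by (simp add: maximal_ideal_in_def)
  let ?J = "{x + s * r | x r. x \<in> m \<and> r \<in> C}"
  have "ideal_in C ?J"
    unfolding ideal_in_def
  proof (intro conjI ballI subsetI)
    show "x \<in> C" if "x \<in> ?J" for x
      using that C I s is_subringD(2,3) ideal_inD(1) by blast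
    show "0 \<in> ?J"
      using ideal_inD(2)[OF I] is_subringD(5)[OF C] by force
    show "x + y \<in> ?J" if "x \<in> ?J" "y \<in> ?J" for x y
    proof -
      obtain a b c d where "x = a + s * c" "y = b + s * d" "a \<in> m" "b \<in> m" "c \<in> C" "d \<in> C"
        using \<open>x \<in> ?J\<close> \<open>y \<in> ?J\<close> by auto
      then show ?thesis
        using ideal_inD(3)[OF I] is_subringD(2)[OF C]
        by (intro CollectI exI[of _ "a + b"] exI[of _ "c + d"]) (auto simp: distrib_left)
    qed
    show "- x \<in> ?J" if "x \<in> ?J" for x
    proof -
      obtain a c where "x = a + s * c" "a \<in> m" "c \<in> C"
        using \<open>x \<in> ?J\<close> by auto
      then show ?thesis
        using ideal_inD(4)[OF I] is_subringD(4)[OF C]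
        by (intro CollectI exI[of _ "- a"] exI[of _ "- c"]) auto
    qed
    fix t x assume t: "t \<in> C" and "x \<in> ?J"
    then obtain a c where x: "x = a + s * c" "a \<in> m" "c \<in> C"
      by auto
    have "t * x = t * a + s * (t * c)"
      unfolding x(1) distrib_left by (simp add: comm[OF s(1) t] flip: mult.assoc)
    then show "t * x \<in> ?J"
      using ideal_inD(6)[OF I t x(2)] is_subringD(3)[OF C t x(3)] by blast
    have "x * t = a * t + s * (c * t)"
      unfolding x(1) by (simp add: distrib_right mult.assoc)
    then show "x * t \<in> ?J"
      using ideal_inD(7)[OF I t x(2)] is_subringD(3)[OF C x(3) t] by blast
  qed
  moreover have "x = x + s * 0" for x
    by simp
  then have "m \<subseteq> ?J"
    using is_subringD(5)[OF C] by blast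
  moreover have "0 + s * 1 \<in> ?J"
    using ideal_inD(2)[OF I] is_subringD(1)[OF C] by blast
  then have "?J \<noteq> m"
    using s(2) by (auto simp del: mem_Collect_eq)
  ultimately have "?J = C"
    using m unfolding maximal_ideal_in_def by blast
  then obtain x r where "x + s * r = 1" "x \<in> m" "r \<in> C"
    using is_subringD(1)[OF C] by force
  then show thesis
    using that[of r] by (metis add_diff_cancel_right')
qed

lemma maximal_ideal_in_prime:
  fixes C :: "'a::ring_1 set"
  assumes C: "is_subring C" and comm: "\<And>x y. x \<in> C \<Longrightarrow> y \<in> C \<Longrightarrow> x * y = y * x"
    and m: "maximal_ideal_in C m" and "a \<in> C" "b \<in> C" "a * b \<in> m"
  shows "a \<in> m \<or> b \<in> m"
proof (rule ccontr)
  assume *: "\<not> (a \<in> m \<or> b \<in> m)"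
  then obtain r where r: "r \<in> C" "1 - a * r \<in> m"
    using maximal_ideal_in_inverse[OF C comm m \<open>a \<in> C\<close>] by blast
  have I: "ideal_in C m"
    using m by (simp add: maximal_ideal_in_def)
  have "(1 - a * r) * b + a * b * r = b"
    using comm[OF \<open>b \<in> C\<close> r(1)] by (simp add: left_diff_distrib mult.assoc)
  moreover have "(1 - a * r) * b + a * b * r \<in> m"
    using ideal_inD(3)[OF I ideal_inD(7)[OF I \<open>b \<in> C\<close> r(2)] ideal_inD(7)[OF I r(1) \<open>a * b \<in> m\<close>]] .
  ultimately show False
    using * by simp
qed

lemma maximal_ideal_in_power:
  fixes C :: "'a::ring_1 set"
  assumes C: "is_subring C" and comm: "\<And>x y. x \<in> C \<Longrightarrow> y \<in> C \<Longrightarrow> x * y = y * x"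
    and m: "maximal_ideal_in C m" and "s \<in> C" "s \<notin> m"
  shows "s ^ n \<notin> m"
proof (induction n)
  case 0
  have I: "ideal_in C m" and "m \<noteq> C"
    using m by (auto simp: maximal_ideal_in_def)
  then obtain x where x: "x \<in> C" "x \<notin> m"
    using ideal_inD(1) by blast
  have "1 \<notin> m"
    using ideal_inD(6)[OF I x(1), of 1] x(2) by auto
  then show ?case
    by simp
next
  case (Suc n)
  then show ?case
    using maximal_ideal_in_prime[OF C comm m \<open>s \<in> C\<close> is_subring_power[OF C \<open>s \<in> C\<close>, of n]] assms(5)
    by auto
qed

text \<open>While the constant coefficient lies in \<open>P\<close>, primality allows a factor
  \<open>x\<close> to be cancelled from the relation. This stops before degree \<open>0\<close>,
  where the relation would read \<open>1 \<in> P\<close>; the constant coefficient reached is a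
  multiple of \<open>x\<close> modulo \<open>P\<close>.\<close>

lemma integral_constant_term:
  fixes P :: "'a::ring_1 set"
  assumes P: "ideal_in UNIV P" "1 \<notin> P" "\<And>a b. a * b \<in> P \<Longrightarrow> a \<in> P \<or> b \<in> P"
    and "x \<notin> P" "\<forall>i<n. c i \<in> C" "x ^ n + (\<Sum>i<n. c i * x ^ i) \<in> P"
    and central: "\<And>c. c \<in> C \<Longrightarrow> c * x = x * c"
  shows "\<exists>d y. d \<in> C \<and> d \<notin> P \<and> d - x * y \<in> P"
  using assms(5,6)
proof (induction n arbitrary: c)
  case 0
  then show ?case
    using P(2) by simp
next
  case (Suc n)
  let ?y = "x ^ n + (\<Sum>i<n. c (Suc i) * x ^ i)"
  have "x * ?y = x ^ Suc n + (\<Sum>i<n. c (Suc i) * x ^ Suc i)"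
  proof -
    have "x * (c (Suc i) * x ^ i) = c (Suc i) * x ^ Suc i" if "i < n" for i
    proof -
      have "c (Suc i) * x = x * c (Suc i)"
        using central Suc.prems(1) that by blast
      then show ?thesis
        by (simp flip: mult.assoc)
    qed
    then show ?thesis
      by (simp add: distrib_left sum_distrib_left)
  qed
  then have eq: "x ^ Suc n + (\<Sum>i<Suc n. c i * x ^ i) = c 0 + x * ?y"
    by (simp add: sum.lessThan_Suc_shift del: sum.lessThan_Suc)
  show ?case
  proof (cases "c 0 \<in> P")
    case True
    then have "x * ?y \<in> P"
      using Suc.prems(2) ideal_in_add_left_iff[OF P(1)] unfolding eq by blast
    then have "?y \<in> P"
      using P(3) \<open>x \<notin> P\<close> by blast
    then show ?thesis
      using Suc.IH[of "\<lambda>i. c (Suc i)"] Suc.prems(1) by simp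
  next
    case False
    moreover have "c 0 - x * (- ?y) \<in> P"
      using Suc.prems(2) unfolding eq mult_minus_right diff_minus_eq_add .
    ultimately show ?thesis
      using Suc.prems(1) by blast
  qed
qed

text \<open>Modulo a completely prime \<open>P\<close> without \<open>c\<close>, some central
  \<open>d \<notin> P\<close> is a multiple of \<open>c\<close>. The Hilbert property gives a
  maximal ideal \<open>m\<close> of the center that contains \<open>P \<inter> center\<close> but
  not \<open>d\<close>. An ideal \<open>M\<close> above \<open>P\<close> whose central elements lie
  in \<open>m\<close> then cannot contain \<open>c\<close>.\<close>

lemma exists_maximal_ideal_avoiding:
  fixes c :: "'a::ring_1"
  assumes red: "reduced_ring TYPE('a)" and int: "integral_over (center :: 'a set)"
    and hil: "hilbert_on (center :: 'a set)" and "c \<noteq> 0"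
  obtains M :: "'a set" where "maximal_ideal_in UNIV M" "c \<notin> M"
proof -
  let ?C = "center :: 'a set"
  have C: "is_subring ?C" and comm: "\<And>x y. x \<in> ?C \<Longrightarrow> x * y = y * x"
    using is_subring_center centerD by blast+
  have "{c} \<inter> I \<noteq> {}" if "reduced_ideal I" "x \<in> {c}" "y \<in> {c}" "x * y \<in> I" for I x y
    using that unfolding reduced_ideal_def by blast
  then obtain P where prime: "prime_ideal_in UNIV P" and "P \<inter> {c} = {}"
    using completely_prime_avoiding[OF red, of "{c}"] \<open>c \<noteq> 0\<close> by (metis empty_not_insert singletonD)
  then have "c \<notin> P"
    by blast
  have P: "ideal_in UNIV P" "1 \<notin> P" "\<And>a b. a * b \<in> P \<Longrightarrow> a \<in> P \<or> b \<in> P"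
    using prime ideal_in_UNIV_eq unfolding prime_ideal_in_def by blast+
  obtain n e where "\<forall>i<n. e i \<in> ?C" "c ^ n + (\<Sum>i<n. e i * c ^ i) = 0"
    using int unfolding integral_over_def by blast
  then have e: "\<forall>i<n. e i \<in> ?C" "c ^ n + (\<Sum>i<n. e i * c ^ i) \<in> P"
    using ideal_inD(2)[OF P(1)] by simp_all
  obtain d y where d: "d \<in> ?C" "d \<notin> P" "d - c * y \<in> P"
    using integral_constant_term[OF P \<open>c \<notin> P\<close> e centerD] by blast
  have "prime_ideal_in ?C (P \<inter> ?C)"
    unfolding prime_ideal_in_def
  proof (intro conjI ballI impI)
    show "ideal_in ?C (P \<inter> ?C)"
      unfolding ideal_in_def using ideal_inD(2-4,6,7)[OF P(1)] is_subringD(2-5)[OF C] by simp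
    show "P \<inter> ?C \<noteq> ?C"
      using P(2) is_subringD(1)[OF C] by blast
    show "a \<in> P \<inter> ?C \<or> b \<in> P \<inter> ?C" if "a \<in> ?C" "b \<in> ?C" "a * b \<in> P \<inter> ?C" for a b
      using P(3)[of a b] that by blast
  qed
  then have "P \<inter> ?C = \<Inter>{M. maximal_ideal_in ?C M \<and> P \<inter> ?C \<subseteq> M}"
    using hil unfolding hilbert_on_def by blast
  then obtain m where m: "maximal_ideal_in ?C m" "P \<inter> ?C \<subseteq> m" "d \<notin> m"
    using d by blast
  have mI: "ideal_in ?C m"
    using m(1) by (simp add: maximal_ideal_in_def)
  \<comment> \<open>\<open>M\<close> will be maximal among the ideals above \<open>P\<close> whose
    central elements all lie in \<open>m\<close>.\<close>
  let ?X = "(\<lambda>s. {s}) ` (?C - m)"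
  have av: "\<not> X \<subseteq> P" and fin: "finite X" if "X \<in> ?X" for X
    using m(2) that by auto
  obtain M where M: "ideal_in UNIV M" "P \<subseteq> M" and avoid: "\<forall>X\<in>?X. \<not> X \<subseteq> M"
    and max: "\<forall>N. ideal_in UNIV N \<and> M \<subset> N \<longrightarrow> (\<exists>X\<in>?X. X \<subseteq> N)"
    by (rule Zorn_avoiding[where P = "ideal_in UNIV", OF _ fin P(1) av]) (rule ideal_in_Union_chain)
  have MC: "s \<in> m" if "s \<in> ?C" "s \<in> M" for s
    using avoid that by blast
  \<comment> \<open>Lying over: if \<open>a \<in> m\<close> is not in \<open>M\<close>, then
    \<open>M + aT\<close> contains a central \<open>s\<close> outside \<open>m\<close>, congruent to
    some \<open>a * b\<close> modulo \<open>M\<close>. As \<open>a\<close> is central, integrality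
    of \<open>b\<close> makes \<open>a * b\<close> a root of a monic polynomial whose lower
    coefficients lie in \<open>m\<close>, and this forces \<open>s ^ n \<in> m\<close>.\<close>
  have "a \<in> M" if "a \<in> m" for a
  proof (rule ccontr)
    assume "a \<notin> M"
    have aC: "a \<in> ?C"
      using that ideal_inD(1)[OF mI] by blast
    let ?N = "{x + a * b | x b. x \<in> M}"
    have "ideal_in UNIV ?N"
      unfolding ideal_in_def
    proof (intro conjI ballI)
      have "0 = 0 + a * 0"
        by simp
      then show "0 \<in> ?N"
        using ideal_inD(2)[OF M(1)] by blast
      show "x + y \<in> ?N" if "x \<in> ?N" "y \<in> ?N" for x y
      proof -
        obtain u v b b' where "x = u + a * b" "y = v + a * b'" "u \<in> M" "v \<in> M"
          using \<open>x \<in> ?N\<close> \<open>y \<in> ?N\<close> by auto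
        then show ?thesis
          using ideal_inD(3)[OF M(1)]
          by (intro CollectI exI[of _ "u + v"] exI[of _ "b + b'"]) (auto simp: distrib_left)
      qed
      show "- x \<in> ?N" if "x \<in> ?N" for x
      proof -
        obtain u b where "x = u + a * b" "u \<in> M"
          using \<open>x \<in> ?N\<close> by auto
        then show ?thesis
          using ideal_inD(4)[OF M(1)]
          by (intro CollectI exI[of _ "- u"] exI[of _ "- b"]) auto
      qed
      fix t x assume "x \<in> ?N"
      then obtain u b where x: "x = u + a * b" "u \<in> M"
        by auto
      have "t * x = t * u + a * (t * b)"
        unfolding x(1) distrib_left using comm[OF aC, of t] by (simp flip: mult.assoc)
      then show "t * x \<in> ?N"
        using ideal_inD(6)[OF M(1) UNIV_I x(2)] by blast
      have "x * t = u * t + a * (b * t)"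
        unfolding x(1) by (simp add: distrib_right mult.assoc)
      then show "x * t \<in> ?N"
        using ideal_inD(7)[OF M(1) UNIV_I x(2)] by blast
    qed auto
    moreover have "x = x + a * 0" for x
      by simp
    then have "M \<subseteq> ?N"
      by blast
    moreover have "a = 0 + a * 1"
      by simp
    then have "a \<in> ?N"
      using ideal_inD(2)[OF M(1)] by blast
    then have "?N \<noteq> M"
      using \<open>a \<notin> M\<close> by metis
    ultimately have "\<exists>X\<in>?X. X \<subseteq> ?N"
      using max[THEN spec, of ?N] by (simp only: psubset_eq simp_thms)
    then obtain s where s: "s \<in> ?C" "s \<notin> m" and "s \<in> ?N"
      by auto
    then obtain x b where xb: "s = x + a * b" "x \<in> M"
      by blast
    obtain n e where e: "\<forall>i<n. e i \<in> ?C" "b ^ n + (\<Sum>i<n. e i * b ^ i) = 0"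
      using int unfolding integral_over_def by blast
    have pow: "(a * b) ^ i = a ^ i * b ^ i" for i
    proof (induction i)
      case (Suc i)
      have "(a * b) ^ Suc i = a * (b * a ^ i) * b ^ i"
        by (simp add: Suc mult.assoc)
      also have "b * a ^ i = a ^ i * b"
        using comm[OF is_subring_power[OF C aC]] by simp
      finally show ?case
        by (simp add: mult.assoc)
    qed simp
    have congr: "s ^ i - (a * b) ^ i \<in> M" for i
    proof (induction i)
      case (Suc i)
      have "s ^ Suc i - (a * b) ^ Suc i = s * (s ^ i - (a * b) ^ i) + (s - a * b) * (a * b) ^ i"
        by (simp add: algebra_simps)
      also have "\<dots> \<in> M"
        using Suc xb ideal_inD[OF M(1)] by simp
      finally show ?case .
    qed (use ideal_inD(2)[OF M(1)] in simp)
    \<comment> \<open>The integral equation of \<open>b\<close>, multiplied by \<open>a ^ n\<close>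
      and with \<open>s\<close> put for \<open>a * b\<close>.\<close>
    let ?v = "s ^ n + (\<Sum>i<n. a ^ (n - i) * e i * s ^ i)"
    have "0 = a ^ n * (b ^ n + (\<Sum>i<n. e i * b ^ i))"
      using e by simp
    also have "\<dots> = (a * b) ^ n + (\<Sum>i<n. a ^ (n - i) * e i * (a * b) ^ i)"
    proof -
      have "a ^ n * (e i * b ^ i) = a ^ (n - i) * e i * (a * b) ^ i" if "i < n" for i
      proof -
        have "a ^ n = a ^ (n - i) * a ^ i"
          using that by (metis le_add_diff_inverse2 less_imp_le power_add)
        then have "a ^ n * (e i * b ^ i) = a ^ (n - i) * (a ^ i * e i) * b ^ i"
          by (simp add: mult.assoc)
        also have "a ^ i * e i = e i * a ^ i"
          using comm[OF is_subring_power[OF C aC]] .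
        finally show ?thesis
          by (simp add: pow mult.assoc)
      qed
      then show ?thesis
        by (simp add: distrib_left sum_distrib_left pow)
    qed
    finally have "?v = (s ^ n - (a * b) ^ n) + (\<Sum>i<n. a ^ (n - i) * e i * (s ^ i - (a * b) ^ i))"
      by (simp add: algebra_simps sum_subtractf)
    also have "\<dots> \<in> M"
      using congr
      by (intro ideal_inD(3)[OF M(1)] ideal_in_sum[OF M(1)] ideal_inD(6)[OF M(1) UNIV_I]) blast+
    finally have "?v \<in> M" .
    moreover have terms: "a ^ (n - i) * e i * s ^ i \<in> m" if "i < n" for i
    proof -
      have "a ^ (n - i) = a * a ^ (n - Suc i)"
        using that by (simp flip: power_Suc add: Suc_diff_Suc)
      then have "a ^ (n - i) \<in> m"
        using ideal_inD(7)[OF mI is_subring_power[OF C aC] \<open>a \<in> m\<close>] by simp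
      then show ?thesis
        using ideal_inD(7)[OF mI] e(1) that is_subring_power[OF C s(1)] by blast
    qed
    then have sum: "(\<Sum>i<n. a ^ (n - i) * e i * s ^ i) \<in> m"
      by (intro ideal_in_sum[OF mI]) auto
    moreover have "?v \<in> ?C"
      using sum ideal_inD(1)[OF mI] is_subringD(2)[OF C] is_subring_power[OF C s(1)] by blast
    ultimately have "s ^ n \<in> m"
      using MC ideal_in_add_left_iff[OF mI sum, of "s ^ n"] by (simp add: add.commute)
    then show False
      using maximal_ideal_in_power[OF C comm m(1) s] by blast
  qed
  then have mM: "m \<subseteq> M"
    by blast
  have "c \<notin> M"
  proof
    assume "c \<in> M"
    then have "(d - c * y) + c * y \<in> M"
      using d(3) M(2) by (intro ideal_inD(3)[OF M(1)] ideal_inD(7)[OF M(1) UNIV_I]) blast+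
    then show False
      using MC[of d] d m(3) by simp
  qed
  moreover have "maximal_ideal_in UNIV M"
    unfolding maximal_ideal_in_def
  proof (intro conjI allI impI)
    show "M \<noteq> UNIV"
      using \<open>c \<notin> M\<close> by blast
    fix J assume J: "ideal_in UNIV J \<and> M \<subseteq> J"
    show "J = M \<or> J = UNIV"
    proof (rule disjCI)
      assume "J \<noteq> UNIV"
      show "J = M"
      proof (rule ccontr)
        assume "J \<noteq> M"
        \<comment> \<open>An ideal beyond \<open>M\<close> contains a central element outside
          \<open>m\<close>, which is invertible modulo \<open>m \<subseteq> M\<close>.\<close>
        then obtain s where s: "s \<in> ?C" "s \<notin> m" "s \<in> J"
          using max[rule_format, of J] J by auto
        then obtain r where "1 - s * r \<in> m"
          using maximal_ideal_in_inverse[OF C comm m(1)] by metis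
        then have "(1 - s * r) + s * r \<in> J"
          using J s mM ideal_inD(3,7)[of UNIV J] by blast
        then show False
          using ideal_in_UNIV_eq[of J] J \<open>J \<noteq> UNIV\<close> by simp
      qed
    qed
  qed (rule M(1))
  ultimately show thesis
    using that by blast
qed

section \<open>Simple rings integral over their center\<close>

definition simple_ring :: "'a::ring_1 itself \<Rightarrow> bool" where
  "simple_ring _ \<longleftrightarrow> (\<forall>I::'a set. ideal_in UNIV I \<longrightarrow> I = {0} \<or> I = UNIV)"

lemma simple_ring_ideal:
  assumes "simple_ring TYPE('a::ring_1)" "ideal_in UNIV I" "x \<in> I" "x \<noteq> (0 :: 'a)"
  shows "y \<in> I"
  using assms unfolding simple_ring_def by blast

lemma left_inverse_power:
  assumes "x * y = (1 :: 'a::ring_1)"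
  shows "x ^ n * y ^ n = 1"
proof (induction n)
  case (Suc n)
  have "x ^ Suc n * y ^ Suc n = x * (x ^ n * y ^ n) * y"
    by (simp add: mult.assoc power_commutes)
  then show ?case
    using Suc assms by simp
qed simp

lemma one_minus_mult_sum_power: "(1 - x) * (\<Sum>i<n. x ^ i) = 1 - (x :: 'a::ring_1) ^ n"
  by (induction n) (simp_all add: distrib_left left_diff_distrib)

text \<open>Centrality makes \<open>cT\<close> a two-sided ideal, so it contains \<open>1\<close>;
  the inverse of a central element is again central.\<close>

lemma simple_ring_center_inverse:
  assumes simple: "simple_ring TYPE('a::ring_1)" and "c \<in> center" "c \<noteq> (0 :: 'a)"
  obtains d where "d \<in> center" "c * d = 1"
proof -
  have c: "c * x = x * c" for x
    using assms(2) by (rule centerD)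
  have "ideal_in UNIV (range (\<lambda>x. c * x))"
    unfolding ideal_in_def
  proof (intro conjI ballI)
    show "0 \<in> range (\<lambda>x. c * x)"
      by (metis mult_zero_right rangeI)
    show "x + y \<in> range (\<lambda>x. c * x)" if "x \<in> range (\<lambda>x. c * x)" "y \<in> range (\<lambda>x. c * x)" for x y
      using that by (auto simp flip: distrib_left)
    show "- x \<in> range (\<lambda>x. c * x)" if "x \<in> range (\<lambda>x. c * x)" for x
      using that by (auto simp flip: mult_minus_right)
    show "s * x \<in> range (\<lambda>x. c * x)" if "x \<in> range (\<lambda>x. c * x)" for s x
    proof -
      obtain y where "x = c * y"
        using \<open>x \<in> range (\<lambda>x. c * x)\<close> by blast
      then have "s * x = c * (s * y)"
        using c[of s] by (simp flip: mult.assoc)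
      then show ?thesis
        by blast
    qed
    show "x * s \<in> range (\<lambda>x. c * x)" if "x \<in> range (\<lambda>x. c * x)" for s x
      using that by (auto simp: mult.assoc)
  qed simp
  moreover have "c \<in> range (\<lambda>x. c * x)"
    by (metis mult.right_neutral rangeI)
  ultimately have "1 \<in> range (\<lambda>x. c * x)"
    using simple_ring_ideal[OF simple] assms(3) by blast
  then obtain d where d: "c * d = 1"
    by (metis imageE)
  have "d * x = x * d" for x
  proof -
    have "d * x = d * (x * c) * d"
      by (simp add: d mult.assoc)
    also have "x * c = c * x"
      using c by simp
    also have "d * (c * x) * d = (d * c) * x * d"
      by (simp add: mult.assoc)
    also have "d * c = 1"
      using d c by simp
    finally show ?thesis
      by simp
  qed
  then have "d \<in> center"
    unfolding center_def by blast
  with d show thesis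
    using that by blast
qed

text \<open>The elements \<open>z\<close> with \<open>u * x * z = 0\<close> for all \<open>x\<close>
  form a two-sided ideal; containing \<open>e\<close>, it contains \<open>1\<close>.\<close>

lemma simple_ring_prime:
  assumes simple: "simple_ring TYPE('a::ring_1)" and "e \<noteq> (0 :: 'a)" "\<And>x. u * x * e = 0"
  shows "u = 0"
proof -
  have "ideal_in UNIV {z. \<forall>x. u * x * z = 0}"
    unfolding ideal_in_def
  proof (intro conjI ballI)
    fix s x assume "x \<in> {z. \<forall>x. u * x * z = 0}"
    then have x: "u * y * x = 0" for y
      by blast
    have "u * y * (s * x) = 0" "u * y * (x * s) = 0" for y
      using x[of "y * s"] x[of y] by (simp_all flip: mult.assoc)
    then show "s * x \<in> {z. \<forall>x. u * x * z = 0}" "x * s \<in> {z. \<forall>x. u * x * z = 0}"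
      by blast+
  qed (simp_all add: distrib_left)
  moreover have "e \<in> {z. \<forall>x. u * x * z = 0}"
    using assms(3) by simp
  ultimately have "1 \<in> {z. \<forall>x. u * x * z = 0}"
    using simple_ring_ideal[OF simple] assms(2) by blast
  then have "u * 1 * 1 = 0"
    by blast
  then show ?thesis
    by simp
qed

text \<open>With respect to the Peirce decomposition of \<open>e\<close>, the block triangular matrices form a
  maximal subring.\<close>

lemma maximal_subring_idempotent:
  fixes e :: "'a::ring_1"
  assumes simple: "simple_ring TYPE('a)" and e: "e * e = e" "e \<noteq> 0" "e \<noteq> 1"
  shows "has_maximal_subring TYPE('a)"
proof -
  define f where "f = 1 - e"
  have fe: "f * f = f" "f * e = 0" "e * f = 0" "f \<noteq> 0" "e + f = 1"
    using e by (auto simp: f_def algebra_simps)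
  \<comment> \<open>The block triangular elements: the corner \<open>f * x * e\<close>
    vanishes.\<close>
  define S where "S = {x. f * x * e = 0}"
  have "is_subring S"
    unfolding is_subring_def
  proof (intro conjI ballI)
    fix x y assume "x \<in> S" "y \<in> S"
    then have xy: "f * x * e = 0" "f * y * e = 0"
      by (simp_all add: S_def)
    have "f * (x * y) * e = f * x * (e + f) * y * e"
      by (simp add: fe mult.assoc)
    also have "\<dots> = (f * x * e) * y * e + f * x * (f * y * e)"
      by (simp add: distrib_left distrib_right mult.assoc)
    finally show "x * y \<in> S"
      using xy by (simp add: S_def)
    show "x + y \<in> S"
      using xy by (simp add: S_def distrib_left distrib_right)
  qed (auto simp: S_def fe)
  moreover have "S \<noteq> UNIV"
  proof
    assume "S = UNIV"
    then have "f * x * e = 0" for x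
      unfolding S_def by blast
    then show False
      using simple_ring_prime[OF simple e(2)] fe by blast
  qed
  moreover have "R = UNIV" if R: "is_subring R" and "S \<subseteq> R" "R \<noteq> S" for R
  proof -
    note Rs = is_subringD[OF R]
    have SR: "x \<in> R" if "f * x * e = 0" for x
      using \<open>S \<subseteq> R\<close> that unfolding S_def by blast
    obtain r where r: "r \<in> R" "r \<notin> S"
      using \<open>S \<subseteq> R\<close> \<open>R \<noteq> S\<close> by blast
    \<comment> \<open>A nonzero element of the corner \<open>fTe\<close> that lies in
      \<open>R\<close>.\<close>
    define y where "y = f * r * e"
    have "f * f * e = 0" "f * e * e = 0"
      by (simp_all add: fe)
    then have "f \<in> R" "e \<in> R"
      using SR by blast+
    then have y: "y \<in> R" "y \<noteq> 0" "f * y * e = y"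
      using r Rs(3) by (auto simp: y_def S_def mult.assoc e) (simp add: fe flip: mult.assoc)
    \<comment> \<open>This ideal contains \<open>y\<close> because the diagonal blocks
      \<open>fTf\<close> and \<open>eTe\<close> lie in \<open>S\<close>. By simplicity it contains
      \<open>1\<close>, which puts the whole corner \<open>fTe\<close> into
      \<open>R\<close>.\<close>
    let ?I = "{z. \<forall>a b. f * a * z * b * e \<in> R}"
    have "ideal_in UNIV ?I"
      unfolding ideal_in_def
    proof (intro conjI ballI)
      show "0 \<in> ?I"
        using Rs(5) by simp
      show "x + z \<in> ?I" if "x \<in> ?I" "z \<in> ?I" for x z
        using that Rs(2) by (simp add: distrib_left distrib_right)
      show "- x \<in> ?I" if "x \<in> ?I" for x
        using that Rs(4) by simp
      show "s * x \<in> ?I" if "x \<in> ?I" for s x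
      proof -
        have "f * (a * s) * x * b * e \<in> R" for a b
          using that by blast
        then show ?thesis
          by (simp add: mult.assoc)
      qed
      show "x * s \<in> ?I" if "x \<in> ?I" for s x
      proof -
        have "f * a * x * (s * b) * e \<in> R" for a b
          using that by blast
        then show ?thesis
          by (simp add: mult.assoc)
      qed
    qed simp
    moreover have "y \<in> ?I"
    proof -
      have "f * a * y * b * e \<in> R" for a b
      proof -
        have "f * (f * a * f) * e = 0" "f * (e * b * e) * e = 0"
          by (simp_all add: fe mult.assoc) (simp add: fe flip: mult.assoc)
        then have "(f * a * f) * y * (e * b * e) \<in> R"
          using SR y(1) Rs(3) by blast
        moreover have "(f * a * f) * y * (e * b * e) = f * a * (f * y * e) * b * e"
          by (simp add: mult.assoc)
        ultimately show ?thesis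
          by (simp add: y(3))
      qed
      then show ?thesis
        by blast
    qed
    ultimately have "1 \<in> ?I"
      using simple_ring_ideal[OF simple] y(2) by blast
    then have low: "f * t * 1 * 1 * e \<in> R" for t
      by blast
    have "t \<in> R" for t
    proof -
      have "f * (t - f * t * e) * e = f * t * e - (f * f) * t * (e * e)"
        by (simp add: algebra_simps mult.assoc)
      then have "t - f * t * e \<in> R"
        using SR fe e by simp
      then show ?thesis
        using Rs(2)[OF _ low[of t], of "t - f * t * e"] by simp
    qed
    then show ?thesis
      by blast
  qed
  ultimately have "is_maximal_subring S"
    unfolding is_maximal_subring_def by metis
  then show ?thesis
    by (rule has_maximal_subringI)
qed

text \<open>The factor \<open>x ^ j\<close> carries the induction: if the constant coefficient
  vanishes, one more factor \<open>x\<close> is split off the polynomial and joins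
  \<open>x ^ j\<close>; otherwise it is a unit by \<open>field\<close>, and the relation can be
  solved for \<open>x ^ j\<close>. In degree \<open>0\<close> it says
  \<open>x ^ j = 0\<close>.\<close>

lemma integral_strongly_pi_regular:
  fixes x :: "'a::ring_1"
  assumes field: "\<And>c. c \<in> center \<Longrightarrow> c \<noteq> (0 :: 'a) \<Longrightarrow> \<exists>d\<in>center. c * d = 1"
    and "\<forall>i<n. c i \<in> center" "x ^ j * (x ^ n + (\<Sum>i<n. c i * x ^ i)) = 0"
  shows "\<exists>k w. x ^ k = x ^ Suc k * w \<and> x * w = w * x"
  using assms(2,3)
proof (induction n arbitrary: j c)
  case 0
  then have "x ^ j = x ^ Suc j * 0"
    by simp
  then show ?case
    by (metis mult_zero_left mult_zero_right)
next
  case (Suc n)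
  let ?z = "x ^ n + (\<Sum>i<n. c (Suc i) * x ^ i)"
  have c: "c i * x = x * c i" if "i < Suc n" for i
    using centerD Suc.prems(1) that by blast
  have xz: "x * ?z = x ^ Suc n + (\<Sum>i<n. c (Suc i) * x ^ Suc i)"
  proof -
    have "x * (c (Suc i) * x ^ i) = c (Suc i) * x ^ Suc i" if "i < n" for i
      using c[of "Suc i"] that by (simp flip: mult.assoc)
    then show ?thesis
      by (simp add: distrib_left sum_distrib_left)
  qed
  have zx: "?z * x = x * ?z"
    unfolding xz by (simp add: distrib_right sum_distrib_right mult.assoc power_commutes)
  have eq: "x ^ Suc n + (\<Sum>i<Suc n. c i * x ^ i) = c 0 + x * ?z"
    unfolding xz by (simp add: sum.lessThan_Suc_shift del: sum.lessThan_Suc)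
  show ?case
  proof (cases "c 0 = 0")
    case True
    then have "x ^ Suc j * ?z = 0"
      using Suc.prems(2) unfolding eq by (simp only: power_Suc2 mult.assoc add_0)
    then show ?thesis
      using Suc.IH[of "\<lambda>i. c (Suc i)" "Suc j"] Suc.prems(1) by simp
  next
    case False
    then obtain d where d: "d \<in> center" "c 0 * d = 1"
      using field Suc.prems(1) by blast
    have "x ^ j * (c 0 + x * ?z) * d = 0"
      using Suc.prems(2) unfolding eq by simp
    then have "x ^ j * (c 0 * d) + x ^ j * x * (?z * d) = 0"
      by (simp add: distrib_left distrib_right mult.assoc)
    then have "x ^ j = x ^ Suc j * (- (?z * d))"
      unfolding d(2) by (simp add: power_Suc2 eq_neg_iff_add_eq_0 del: power_Suc)
    moreover have "(?z * d) * x = (?z * x) * d"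
      by (simp only: mult.assoc centerD[OF d(1), of x])
    then have "x * (?z * d) = (?z * d) * x"
      unfolding zx by (simp only: mult.assoc)
    then have "x * (- (?z * d)) = - (?z * d) * x"
      by simp
    ultimately show ?thesis
      by blast
  qed
qed

text \<open>If \<open>x ^ k = x ^ Suc k * w\<close> with \<open>w\<close> commuting with
  \<open>x\<close>, then \<open>x ^ k * w ^ k\<close> is idempotent, hence \<open>0\<close> or
  \<open>1\<close>, as any other idempotent gives a maximal subring. In the first case
  \<open>x ^ k = 0\<close>, in the second \<open>x\<close> is a unit.\<close>

lemma simple_ring_unit_or_nilpotent:
  fixes x :: "'a::ring_1"
  assumes simple: "simple_ring TYPE('a)" and int: "integral_over (center :: 'a set)"
    and "\<not> has_maximal_subring TYPE('a)"
  shows "(\<exists>y. x * y = 1 \<and> y * x = 1) \<or> (\<exists>k. x ^ k = 0)"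
proof -
  obtain n c where "\<forall>i<n. c i \<in> center" "x ^ n + (\<Sum>i<n. c i * x ^ i) = 0"
    using int unfolding integral_over_def by blast
  then have "\<forall>i<n. c i \<in> center" "x ^ 0 * (x ^ n + (\<Sum>i<n. c i * x ^ i)) = 0"
    by simp_all
  moreover have "\<exists>d\<in>center. c * d = 1" if "c \<in> center" "c \<noteq> 0" for c :: 'a
    using simple_ring_center_inverse[OF simple that] by blast
  ultimately obtain k w where kw: "x ^ k = x ^ Suc k * w" "x * w = w * x"
    using integral_strongly_pi_regular[of n c x 0] by blast
  have pow: "x ^ k = x ^ (k + i) * w ^ i" for i
  proof (induction i)
    case (Suc i)
    have "x ^ (k + Suc i) * w ^ Suc i = x ^ i * (x ^ Suc k * w) * w ^ i"
      using power_add[of x i "Suc k"] by (simp add: mult.assoc add.commute del: power_Suc add: power_Suc[of w])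
    also have "\<dots> = x ^ (k + i) * w ^ i"
      unfolding kw(1)[symmetric] using power_add[of x i k] by (simp add: add.commute)
    finally show ?case
      using Suc by simp
  qed simp
  have comm: "w ^ i * x ^ j = x ^ j * w ^ i" for i j
    by (metis kw(2) power_commuting_commutes)
  let ?e = "x ^ k * w ^ k"
  have "?e * ?e = x ^ k * (w ^ k * x ^ k) * w ^ k"
    by (simp add: mult.assoc)
  also have "\<dots> = x ^ (k + k) * w ^ k * w ^ k"
    unfolding comm by (simp add: power_add mult.assoc)
  also have "\<dots> = ?e"
    by (simp flip: pow)
  finally have "?e = 0 \<or> ?e = 1"
    using maximal_subring_idempotent[OF simple] assms(3) by blast
  then show ?thesis
  proof
    assume "?e = 0"
    have "x ^ k = ?e * x ^ k"
      using pow[of k] comm[of k k] by (metis mult.assoc power_add)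
    then show ?thesis
      using \<open>?e = 0\<close> by (metis mult_zero_left)
  next
    assume e: "?e = 1"
    show ?thesis
    proof (cases k)
      case 0
      \<comment> \<open>For \<open>k = 0\<close> the idempotent has no factor \<open>x\<close>, but
        the relation itself reads \<open>1 = x * w\<close>.\<close>
      then have "x * w = 1" "w * x = 1"
        using kw by simp_all
      then show ?thesis
        by blast
    next
      case (Suc l)
      have "x * (x ^ l * w ^ k) = 1"
        using e by (simp add: Suc mult.assoc)
      moreover have "(x ^ l * w ^ k) * x = 1"
        using e comm[of k 1] by (simp add: Suc power_commutes mult.assoc) (metis mult.assoc power_commutes)
      ultimately show ?thesis
        by blast
    qed
  qed
qed

text \<open>Every nonunit is nilpotent, and the nilpotent elements form a two-sided ideal without
  \<open>1\<close>, which simplicity makes zero.\<close>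

lemma simple_ring_division:
  fixes x :: "'a::ring_1"
  assumes simple: "simple_ring TYPE('a)" and int: "integral_over (center :: 'a set)"
    and nomax: "\<not> has_maximal_subring TYPE('a)" and "x \<noteq> 0"
  shows "\<exists>y. x * y = 1 \<and> y * x = 1"
proof (rule ccontr)
  assume nunit: "\<nexists>y. x * y = 1 \<and> y * x = 1"
  let ?N = "{x :: 'a. \<exists>k. x ^ k = 0}"
  note unit = simple_ring_unit_or_nilpotent[OF simple int nomax]
  have no_inv: "a * b \<noteq> 1" "b * a \<noteq> 1" if a: "a \<in> ?N" for a b :: 'a
  proof -
    obtain k where "a ^ k = 0"
      using a by blast
    then show "a * b \<noteq> 1" "b * a \<noteq> 1"
      using left_inverse_power[of a b k] left_inverse_power[of b a k] by auto
  qed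
  have mult: "a * b \<in> ?N" "b * a \<in> ?N" if "a \<in> ?N" for a b
  proof -
    have "a * b * z \<noteq> 1" "z * (b * a) \<noteq> 1" for z
      using no_inv[OF that] by (metis mult.assoc)+
    then show "a * b \<in> ?N" "b * a \<in> ?N"
      using unit[of "a * b"] unit[of "b * a"] by blast+
  qed
  have "a + b \<in> ?N" if ab: "a \<in> ?N" "b \<in> ?N" for a b
  proof (rule ccontr)
    assume "a + b \<notin> ?N"
    then obtain u where "u * (a + b) = 1"
      using unit[of "a + b"] by blast
    \<comment> \<open>As \<open>u * a\<close> is nilpotent, a geometric sum is a right inverse of
      \<open>u * b\<close>; but \<open>u * b\<close> is nilpotent too.\<close>
    then have "u * b = 1 - u * a"
      by (simp add: distrib_left eq_diff_eq add.commute)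
    moreover obtain k where k: "(u * a) ^ k = 0"
      using mult(2)[OF ab(1)] by blast
    ultimately have "(u * b) * (\<Sum>i<k. (u * a) ^ i) = 1"
      using one_minus_mult_sum_power[of "u * a" k] by simp
    then show False
      using no_inv(1)[OF mult(2)[OF ab(2)]] by blast
  qed
  moreover have "- a \<in> ?N" if "a \<in> ?N" for a
    using mult(2)[OF that, of "- 1"] by simp
  moreover have "0 ^ 1 = (0 :: 'a)"
    by simp
  then have "0 \<in> ?N"
    by blast
  ultimately have "ideal_in UNIV ?N"
    using mult unfolding ideal_in_def by blast
  moreover have "x \<in> ?N"
    using unit[of x] nunit by blast
  ultimately have "1 \<in> ?N"
    using simple_ring_ideal[OF simple] \<open>x \<noteq> 0\<close> by blast
  then show False
    by simp
qed

section \<open>Division rings algebraic over their center\<close>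

text \<open>Gaussian elimination with the unknowns on the left: the last equation is solved for the
  unknown at some \<open>x0\<close>, and the result is substituted into the others.\<close>

lemma division_ring_homogeneous_system:
  fixes v :: "nat \<Rightarrow> 'b \<Rightarrow> 'a::ring_1"
  assumes div: "\<And>x :: 'a. x \<noteq> 0 \<Longrightarrow> \<exists>y. x * y = 1 \<and> y * x = 1"
    and "finite X" "n < card X"
  shows "\<exists>d. (\<exists>x\<in>X. d x \<noteq> 0) \<and> (\<forall>i<n. (\<Sum>x\<in>X. d x * v i x) = 0)"
  using assms(2,3)
proof (induction n arbitrary: X v)
  case 0
  then show ?case
    by (intro exI[of _ "\<lambda>_. 1"]) (auto simp: card_gt_0_iff)
next
  case (Suc n)
  show ?case
  proof (cases "\<forall>x\<in>X. v n x = 0")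
    case True
    then show ?thesis
      using Suc.IH[of X v] Suc.prems by (auto simp: less_Suc_eq)
  next
    case False
    then obtain x0 where x0: "x0 \<in> X" "v n x0 \<noteq> 0"
      by blast
    then obtain r where r: "r * v n x0 = 1"
      using div by blast
    let ?X = "X - {x0}"
    obtain d where d: "\<exists>x\<in>?X. d x \<noteq> 0"
      "\<forall>i<n. (\<Sum>x\<in>?X. d x * (v i x - v n x * r * v i x0)) = 0"
    proof -
      have "n < card ?X"
        using Suc.prems x0(1) by simp
      then show thesis
        using Suc.IH[of ?X "\<lambda>i x. v i x - v n x * r * v i x0"] Suc.prems(1) that by auto
    qed
    \<comment> \<open>The value at \<open>x0\<close> is forced by the last equation, since
      \<open>r\<close> inverts \<open>v n x0\<close>.\<close>
    define e where "e = d(x0 := - (\<Sum>x\<in>?X. d x * v n x * r))"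
    have split: "(\<Sum>x\<in>X. e x * v i x) = (\<Sum>x\<in>?X. d x * (v i x - v n x * r * v i x0))" for i
    proof -
      have "(\<Sum>x\<in>X. e x * v i x) = e x0 * v i x0 + (\<Sum>x\<in>?X. e x * v i x)"
        using Suc.prems(1) x0(1) by (rule sum.remove)
      also have "(\<Sum>x\<in>?X. e x * v i x) = (\<Sum>x\<in>?X. d x * v i x)"
        by (auto simp: e_def intro!: sum.cong)
      also have "e x0 * v i x0 = - (\<Sum>x\<in>?X. d x * (v n x * r * v i x0))"
        by (simp add: e_def sum_distrib_right mult.assoc)
      finally show ?thesis
        by (simp add: right_diff_distrib sum_subtractf)
    qed
    have "(\<Sum>x\<in>X. e x * v n x) = 0"
      unfolding split by (rule sum.neutral) (simp add: mult.assoc r)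
    then have "\<forall>i<Suc n. (\<Sum>x\<in>X. e x * v i x) = 0"
      using d(2) split by (simp add: less_Suc_eq)
    moreover have "\<exists>x\<in>X. e x \<noteq> 0"
      using d(1) by (auto simp: e_def)
    ultimately show ?thesis
      by blast
  qed
qed

definition independent_over :: "'a::ring_1 set \<Rightarrow> 'a set \<Rightarrow> bool" where
  "independent_over E X \<longleftrightarrow> finite X \<and>
     (\<forall>d. (\<forall>x\<in>X. d x \<in> E) \<and> (\<Sum>x\<in>X. d x * x) = 0 \<longrightarrow> (\<forall>x\<in>X. d x = 0))"

text \<open>Artin's argument: a relation of minimal support among the vectors \<open>(x, a * x, a\<^sup>2 * x, \<dots>)\<close>,
  normalised to have a coefficient \<open>1\<close>, has coefficients commuting with \<open>a\<close>.\<close>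

lemma card_independent_over_centralizer:
  fixes a :: "'a::ring_1"
  assumes div: "\<And>x :: 'a. x \<noteq> 0 \<Longrightarrow> \<exists>y. x * y = 1 \<and> y * x = 1"
    and c: "\<forall>i<n. c i \<in> center" "a ^ n + (\<Sum>i<n. c i * a ^ i) = 0"
    and ind: "independent_over {x. x * a = a * x} X"
  shows "card X \<le> n"
proof (rule ccontr)
  assume "\<not> card X \<le> n"
  have fin: "finite X"
    using ind by (simp add: independent_over_def)
  define Rel where "Rel d \<longleftrightarrow> (\<exists>x\<in>X. d x \<noteq> 0) \<and> (\<forall>i. (\<Sum>x\<in>X. d x * (a ^ i * x)) = 0)" for d
  obtain d where d: "\<exists>x\<in>X. d x \<noteq> 0" "\<And>i. i < n \<Longrightarrow> (\<Sum>x\<in>X. d x * (a ^ i * x)) = 0"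
    using division_ring_homogeneous_system[OF div fin, of n "\<lambda>i x. a ^ i * x"] \<open>\<not> card X \<le> n\<close>
    by auto
  \<comment> \<open>Since \<open>a ^ n\<close> is a combination of lower powers with central
    coefficients, the relations for \<open>i < n\<close> imply those for all
    \<open>i\<close>.\<close>
  have "(\<Sum>x\<in>X. d x * (a ^ i * x)) = 0" for i
  proof (induction i rule: less_induct)
    case (less i)
    show ?case
    proof (cases "i < n")
      case False
      have "a ^ i = a ^ n * a ^ (i - n)"
        using False by (metis le_add_diff_inverse not_less power_add)
      also have "a ^ n = - (\<Sum>j<n. c j * a ^ j)"
        using c(2) by (simp add: eq_neg_iff_add_eq_0)
      finally have ai: "a ^ i = - (\<Sum>j<n. c j * a ^ (j + (i - n)))"
        by (simp add: sum_distrib_right power_add mult.assoc)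
      have "d x * (a ^ i * x) = - (\<Sum>j<n. c j * (d x * (a ^ (j + (i - n)) * x)))" for x
      proof -
        have "d x * (c j * a ^ (j + (i - n)) * x) = c j * (d x * (a ^ (j + (i - n)) * x))"
          if "j < n" for j
          using centerD[of "c j" "d x"] c(1) that by (metis mult.assoc)
        then show ?thesis
          by (simp add: ai sum_distrib_left sum_distrib_right)
      qed
      then have "(\<Sum>x\<in>X. d x * (a ^ i * x)) = - (\<Sum>x\<in>X. \<Sum>j<n. c j * (d x * (a ^ (j + (i - n)) * x)))"
        by (simp add: sum_negf)
      also have "\<dots> = - (\<Sum>j<n. c j * (\<Sum>x\<in>X. d x * (a ^ (j + (i - n)) * x)))"
        by (subst sum.swap) (simp add: sum_distrib_left)
      also have "\<dots> = 0"
        using less.IH False by simp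
      finally show ?thesis .
    qed (use d(2) in simp)
  qed
  then have "Rel d"
    using d(1) by (simp add: Rel_def)
  then obtain d where "Rel d" and min: "\<And>d'. Rel d' \<Longrightarrow> card {x\<in>X. d x \<noteq> 0} \<le> card {x\<in>X. d' x \<noteq> 0}"
    using arg_min_natI[of Rel d "\<lambda>d. card {x\<in>X. d x \<noteq> 0}"]
      arg_min_nat_le[of Rel _ "\<lambda>d. card {x\<in>X. d x \<noteq> 0}"] by blast
  then obtain x0 where x0: "x0 \<in> X" "d x0 \<noteq> 0" and rel: "\<And>i. (\<Sum>x\<in>X. d x * (a ^ i * x)) = 0"
    unfolding Rel_def by blast
  obtain r where r: "r * d x0 = 1"
    using div x0(2) by blast
  define e where "e x = r * d x" for x
  have e: "(\<Sum>x\<in>X. e x * (a ^ i * x)) = 0" for i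
    using rel[of i] by (simp add: e_def mult.assoc flip: sum_distrib_left)
  have "e x0 = 1"
    by (simp add: e_def r)
  \<comment> \<open>These coefficients satisfy all relations again, by the shift from
    \<open>i\<close> to \<open>Suc i\<close>. Their support is smaller, because the coefficient
    \<open>1\<close> at \<open>x0\<close> commutes with \<open>a\<close>; so they all
    vanish.\<close>
  have "\<not> Rel (\<lambda>x. e x * a - a * e x)"
  proof
    assume "Rel (\<lambda>x. e x * a - a * e x)"
    then have "card {x\<in>X. d x \<noteq> 0} \<le> card {x\<in>X. e x * a - a * e x \<noteq> 0}"
      by (rule min)
    moreover have "x0 \<notin> {x\<in>X. e x * a - a * e x \<noteq> 0}" "x0 \<in> {x\<in>X. d x \<noteq> 0}"
      using x0 \<open>e x0 = 1\<close> by simp_all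
    then have "{x\<in>X. e x * a - a * e x \<noteq> 0} \<subset> {x\<in>X. d x \<noteq> 0}"
      by (auto simp: e_def)
    ultimately show False
      using psubset_card_mono[of "{x\<in>X. d x \<noteq> 0}"] fin by (simp add: not_less[symmetric])
  qed
  moreover have "(\<Sum>x\<in>X. (e x * a - a * e x) * (a ^ i * x)) = 0" for i
  proof -
    have "(e x * a - a * e x) * (a ^ i * x) = e x * (a ^ Suc i * x) - a * (e x * (a ^ i * x))" for x
      by (simp add: left_diff_distrib mult.assoc)
    then show ?thesis
      using e[of "Suc i"] e[of i] by (simp add: sum_subtractf del: power_Suc flip: sum_distrib_left)
  qed
  ultimately have "\<forall>x\<in>X. e x \<in> {x. x * a = a * x}"
    by (auto simp: Rel_def)
  \<comment> \<open>The relation for \<open>i = 0\<close> is now one over the centralizer.\<close>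
  then have "e x0 = 0"
    using ind e[of 0] x0(1) by (simp add: independent_over_def)
  then show False
    using \<open>e x0 = 1\<close> by simp
qed

text \<open>The centralizer \<open>E\<close> of \<open>a\<close> is a proper subring, and
  \<open>card_independent_over_centralizer\<close> bounds the size of independent sets over it. A
  largest one, \<open>X\<close>, spans the ring as a left \<open>E\<close>-module, so
  \<open>E\<close> and \<open>X\<close> generate the ring.\<close>

lemma division_ring_maximal_subring:
  fixes a b :: "'a::ring_1"
  assumes div: "\<And>x :: 'a. x \<noteq> 0 \<Longrightarrow> \<exists>y. x * y = 1 \<and> y * x = 1"
    and int: "integral_over (center :: 'a set)" and "a * b \<noteq> b * a"
  shows "has_maximal_subring TYPE('a)"
proof -
  define E where "E = {x. x * a = a * x}"
  have E: "is_subring E"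
    unfolding is_subring_def
  proof (intro conjI ballI)
    fix x y assume "x \<in> E" "y \<in> E"
    then have xy: "x * a = a * x" "y * a = a * y"
      by (simp_all add: E_def)
    then show "x + y \<in> E"
      by (simp add: E_def distrib_left distrib_right)
    show "x * y \<in> E"
    proof -
      have "x * y * a = (x * a) * y"
        using xy(2) by (simp add: mult.assoc)
      then show ?thesis
        using xy(1) by (simp add: E_def mult.assoc)
    qed
  qed (auto simp: E_def)
  obtain n c where nc: "\<forall>i<n. c i \<in> center" "a ^ n + (\<Sum>i<n. c i * a ^ i) = 0"
    using int unfolding integral_over_def by blast
  have "independent_over E {}"
    by (simp add: independent_over_def)
  moreover have "\<forall>X. independent_over E X \<longrightarrow> card X < Suc n"
    using card_independent_over_centralizer[OF div nc] unfolding E_def by (simp add: less_Suc_eq_le)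
  ultimately obtain X where X: "independent_over E X"
    and max: "\<forall>Y. independent_over E Y \<longrightarrow> card Y \<le> card X"
    using ex_has_greatest_nat[of "independent_over E" "{}" card "Suc n"] by blast
  have fin: "finite X"
    using X by (simp add: independent_over_def)
  show ?thesis
  proof (rule maximal_subring_finitely_generated[OF E _ fin])
    have "b \<notin> E"
      using not_sym[OF assms(3)] by (simp add: E_def)
    then show "E \<noteq> UNIV"
      by blast
    fix R assume R: "is_subring R" "E \<subseteq> R" "X \<subseteq> R"
    note Rs = is_subringD[OF R(1)]
    have "y \<in> R" for y
    proof (rule ccontr)
      assume "y \<notin> R"
      then have "y \<notin> X"
        using R(3) by blast
      then have "\<not> independent_over E (insert y X)"
        using max[rule_format, of "insert y X"] fin by auto
      then obtain d where d: "\<forall>x\<in>insert y X. d x \<in> E" "(\<Sum>x\<in>insert y X. d x * x) = 0"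
        "\<exists>x\<in>insert y X. d x \<noteq> 0"
        using fin unfolding independent_over_def by blast
      have sum: "d y * y + (\<Sum>x\<in>X. d x * x) = 0"
        using d(2) fin \<open>y \<notin> X\<close> by simp
      have "d y \<noteq> 0"
      proof
        assume "d y = 0"
        then show False
          using sum d X unfolding independent_over_def by auto
      qed
      then obtain r where r: "d y * r = 1" "r * d y = 1"
        using div by blast
      have "d y * a = a * d y"
        using d(1) by (simp add: E_def)
      then have "r * (d y * a) * r = r * (a * d y) * r"
        by simp
      then have "(r * d y) * (a * r) = (r * a) * (d y * r)"
        by (simp add: mult.assoc)
      then have "r \<in> E"
        by (simp add: r E_def)
      have "r * (d y * y + (\<Sum>x\<in>X. d x * x)) = (r * d y) * y + r * (\<Sum>x\<in>X. d x * x)"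
        by (simp add: distrib_left mult.assoc)
      then have "y = - (r * (\<Sum>x\<in>X. d x * x))"
        using sum r(2) by (simp add: eq_neg_iff_add_eq_0)
      also have "\<dots> \<in> R"
        using \<open>r \<in> E\<close> d(1) R by (intro Rs(3,4) is_subring_sum) auto
      finally show False
        using \<open>y \<notin> R\<close> by blast
    qed
    then show "R = UNIV"
      by blast
  qed
qed

lemma simple_integral_commutative:
  assumes "simple_ring TYPE('a::ring_1)" "integral_over (center :: 'a set)"
    "\<not> has_maximal_subring TYPE('a)"
  shows "x * y = y * (x :: 'a)"
  using division_ring_maximal_subring[OF simple_ring_division[OF assms] assms(2)] assms(3) by blast

section \<open>Uncountable fields\<close>

definition adjoin :: "'a::comm_ring_1 set \<Rightarrow> 'a \<Rightarrow> 'a set" where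
  "adjoin R x = {poly p x | p. \<forall>i. coeff p i \<in> R}"

lemma adjoinI: "\<forall>i. coeff p i \<in> R \<Longrightarrow> poly p x \<in> adjoin R x"
  by (auto simp: adjoin_def)

lemma adjoin_base:
  assumes "is_subring R"
  shows "R \<subseteq> adjoin R x" "x \<in> adjoin R x"
proof -
  have "a \<in> adjoin R x" if "a \<in> R" for a
    using adjoinI[of "[:a:]" R x] that is_subringD(5)[OF assms]
    by (simp add: coeff_pCons split: nat.split)
  then show "R \<subseteq> adjoin R x"
    by blast
  show "x \<in> adjoin R x"
    using adjoinI[of "[:0, 1:]" R x] is_subringD(1,5)[OF assms]
    by (simp add: coeff_pCons split: nat.split)
qed

lemma is_subring_adjoin:
  assumes R: "is_subring R"
  shows "is_subring (adjoin R x)"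
  unfolding is_subring_def
proof (intro conjI ballI)
  note Rs = is_subringD[OF R]
  show "1 \<in> adjoin R x"
    using adjoin_base(1)[OF R] Rs(1) by blast
  fix a assume "a \<in> adjoin R x"
  then obtain p where p: "a = poly p x" "\<forall>i. coeff p i \<in> R"
    by (auto simp: adjoin_def)
  show "- a \<in> adjoin R x"
    using adjoinI[of "- p" R x] p Rs(4) by simp
  fix b assume "b \<in> adjoin R x"
  then obtain q where q: "b = poly q x" "\<forall>i. coeff q i \<in> R"
    by (auto simp: adjoin_def)
  show "a + b \<in> adjoin R x"
    using adjoinI[of "p + q" R x] p q Rs(2) by simp
  have "coeff (p * q) i \<in> R" for i
    unfolding coeff_mult using p(2) q(2) Rs(3) by (intro is_subring_sum[OF R]) blast
  then show "a * b \<in> adjoin R x"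
    using adjoinI[of "p * q" R x] p q by simp
qed

lemma adjoin_subset:
  assumes R: "is_subring R" and "S \<subseteq> R" "x \<in> R"
  shows "adjoin S x \<subseteq> R"
proof -
  have "poly p x \<in> R" if "\<forall>i. coeff p i \<in> S" for p
    unfolding poly_altdef using assms that
    by (intro is_subring_sum[OF R] is_subringD(3)[OF R] is_subring_power[OF R]) blast+
  then show ?thesis
    by (auto simp: adjoin_def)
qed

text \<open>For a unit \<open>b\<close> of the ambient ring this is \<open>R[1/b]\<close>;
  denominators appear as multipliers, so that no division occurs.\<close>

lemma is_subring_localization:
  fixes b :: "'a::comm_ring_1"
  assumes R: "is_subring R" and "b \<in> R"
  shows "is_subring {y. \<exists>n. y * b ^ n \<in> R}"
  unfolding is_subring_def
proof (intro conjI ballI)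
  note Rs = is_subringD[OF R]
  have b: "b ^ n \<in> R" for n
    using is_subring_power[OF R \<open>b \<in> R\<close>] .
  have "1 * b ^ 0 \<in> R"
    using Rs(1) by simp
  then show "1 \<in> {y. \<exists>n. y * b ^ n \<in> R}"
    by blast
  fix x assume "x \<in> {y. \<exists>n. y * b ^ n \<in> R}"
  then obtain n where x: "x * b ^ n \<in> R"
    by blast
  have "(- x) * b ^ n \<in> R"
    using Rs(4)[OF x] by simp
  then show "- x \<in> {y. \<exists>n. y * b ^ n \<in> R}"
    by blast
  fix y assume "y \<in> {y. \<exists>n. y * b ^ n \<in> R}"
  then obtain m where y: "y * b ^ m \<in> R"
    by blast
  have "(x + y) * b ^ (n + m) = (x * b ^ n) * b ^ m + (y * b ^ m) * b ^ n"
    by (simp add: power_add algebra_simps)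
  then show "x + y \<in> {y. \<exists>n. y * b ^ n \<in> R}"
    using Rs(2)[OF Rs(3)[OF x b] Rs(3)[OF y b]] by (metis (mono_tags) mem_Collect_eq)
  have "(x * y) * b ^ (n + m) = (x * b ^ n) * (y * b ^ m)"
    by (simp add: power_add algebra_simps)
  then show "x * y \<in> {y. \<exists>n. y * b ^ n \<in> R}"
    using Rs(3)[OF x y] by (metis (mono_tags) mem_Collect_eq)
qed

lemma common_denominator:
  fixes b :: "'a::comm_ring_1"
  assumes R: "is_subring R" and "b \<in> R" "finite Y" "\<forall>y\<in>Y. \<exists>n. y * b ^ n \<in> R"
  shows "\<exists>N. \<forall>y\<in>Y. y * b ^ N \<in> R"
  using assms(3,4)
proof (induction Y rule: finite_induct)
  case (insert x Y)
  then obtain N n where N: "\<forall>y\<in>Y. y * b ^ N \<in> R" and n: "x * b ^ n \<in> R"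
    by auto
  have "y * b ^ (n + N) \<in> R" if "y \<in> insert x Y" for y
  proof -
    have "y * b ^ (n + N) = (y * b ^ n) * b ^ N" "y * b ^ (n + N) = (y * b ^ N) * b ^ n"
      by (simp_all add: power_add algebra_simps)
    then show ?thesis
      using that N n is_subringD(3)[OF R] is_subring_power[OF R \<open>b \<in> R\<close>] by (metis insert_iff)
  qed
  then show ?case
    by blast
qed simp

lemma poly_eq_power_mult_poly_shift:
  fixes p :: "'a::comm_ring_1 poly"
  assumes "\<And>j. j < k \<Longrightarrow> coeff p j = 0"
  shows "poly p x = x ^ k * poly (poly_shift k p) x"
proof -
  have "p = monom 1 k * poly_shift k p"
    using assms by (intro poly_eqI) (simp add: coeff_monom_mult coeff_poly_shift)
  then show ?thesis
    by (metis poly_monom poly_mult mult_1)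
qed

lemma poly_eq_coeff_0_plus:
  fixes p :: "'a::comm_ring_1 poly"
  shows "poly p x = coeff p 0 + x * poly (poly_shift 1 p) x"
proof -
  have "p = pCons (coeff p 0) (poly_shift 1 p)"
    by (intro poly_eqI) (simp add: coeff_pCons coeff_poly_shift split: nat.split)
  then show ?thesis
    by (metis poly_pCons)
qed

subsection \<open>Subrings maximal without the inverse of an element\<close>

text \<open>The setting of the classical existence proof for valuation rings, with \<open>t\<close>
  as the prescribed nonunit.\<close>

locale maximal_avoiding_inverse =
  fixes V :: "'a::field set" and t :: 'a
  assumes subring: "is_subring V" and t_in: "t \<in> V" and t_inv: "inverse t \<notin> V"
    and max: "\<And>R. is_subring R \<Longrightarrow> V \<subseteq> R \<Longrightarrow> R \<noteq> V \<Longrightarrow> inverse t \<in> R"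
begin

lemmas V = is_subringD[OF subring]

lemma t_nonzero: "t \<noteq> 0"
  using t_inv V(5) by auto

lemma mult_t_neq_1: "v \<in> V \<Longrightarrow> t * v \<noteq> 1"
  using t_inv inverse_unique[of t v] by auto

text \<open>Powers of \<open>1 - t * w\<close> are congruent to \<open>1\<close> modulo
  \<open>tV\<close>, so localizing at this element does not produce \<open>1/t\<close>. By
  maximality the localization is \<open>V\<close> itself.\<close>

lemma unit:
  assumes "w \<in> V"
  shows "1 - t * w \<noteq> 0" "inverse (1 - t * w) \<in> V"
proof -
  let ?b = "1 - t * w"
  show b0: "?b \<noteq> 0"
    using mult_t_neq_1[OF assms] by auto
  have b: "?b \<in> V"
    by (intro V(1,3,6) assms t_in)
  have "\<exists>w'\<in>V. ?b ^ n = 1 - t * w'" for n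
  proof (induction n)
    case 0
    have "?b ^ 0 = 1 - t * 0"
      by simp
    then show ?case
      using V(5) by blast
  next
    case (Suc n)
    then obtain w' where w': "w' \<in> V" "?b ^ n = 1 - t * w'"
      by blast
    have "?b ^ Suc n = 1 - t * (w + w' - w * (t * w'))"
      unfolding power_Suc w'(2) by (simp add: algebra_simps)
    moreover have "w + w' - w * (t * w') \<in> V"
      by (intro V(2,3,6) w'(1) assms t_in)
    ultimately show ?case
      by blast
  qed
  note pow = this
  have "inverse t * ?b ^ n \<notin> V" for n
  proof -
    obtain w' where w': "w' \<in> V" "?b ^ n = 1 - t * w'"
      using pow[of n] by (rule bexE)
    have "inverse t * ?b ^ n = inverse t - w'"
      unfolding w'(2) using t_nonzero by (simp add: right_diff_distrib)
    moreover have "inverse t - w' \<notin> V"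
      using V(2)[OF _ w'(1), of "inverse t - w'"] t_inv by auto
    ultimately show ?thesis
      by simp
  qed
  then have "inverse t \<notin> {y. \<exists>n. y * ?b ^ n \<in> V}"
    by blast
  moreover have "y * ?b ^ 0 \<in> V" if "y \<in> V" for y
    using that by simp
  then have "V \<subseteq> {y. \<exists>n. y * ?b ^ n \<in> V}"
    by blast
  ultimately have "{y. \<exists>n. y * ?b ^ n \<in> V} = V"
    using max is_subring_localization[OF subring b] by blast
  moreover have "inverse ?b * ?b ^ 1 \<in> V"
    using b0 V(1) by simp
  then have "inverse ?b \<in> {y. \<exists>n. y * ?b ^ n \<in> V}"
    by blast
  ultimately show "inverse ?b \<in> V"
    by simp
qed

lemma inverse_t_in_adjoin:
  assumes "x \<notin> V"
  obtains p where "\<forall>i. coeff p i \<in> V" "t * poly p x = 1"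
proof -
  have "inverse t \<in> adjoin V x"
    using max[OF is_subring_adjoin[OF subring, of x]] adjoin_base[OF subring, of x] assms by blast
  then obtain p where "inverse t = poly p x" "\<forall>i. coeff p i \<in> V"
    by (auto simp: adjoin_def)
  then show thesis
    using that[of p] t_nonzero by (metis right_inverse)
qed

text \<open>As \<open>1 - t * coeff q 0\<close> is a unit of \<open>V\<close>, the relation for
  \<open>y\<close> writes \<open>1\<close> as a combination of positive powers of \<open>y\<close>.
  Multiplied by \<open>x ^ degree p\<close>, it expresses this power of \<open>x\<close> by smaller
  ones, which replaces the leading term of \<open>p\<close>.\<close>

lemma reduce_degree:
  assumes "x * y = 1" and p: "\<forall>i. coeff p i \<in> V" "t * poly p x = 1"
    and q: "\<forall>i. coeff q i \<in> V" "t * poly q y = 1" and "degree q \<le> degree p"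
  shows "\<exists>p'. (\<forall>i. coeff p' i \<in> V) \<and> t * poly p' x = 1 \<and> degree p' < degree p"
proof -
  let ?n = "degree p" and ?m = "degree q"
  define u where "u = inverse (1 - t * coeff q 0)"
  have u: "u \<in> V" "u * (1 - t * coeff q 0) = 1"
    using unit[of "coeff q 0"] q(1) by (simp_all add: u_def)
  have "?n > 0"
  proof (rule ccontr)
    assume "\<not> ?n > 0"
    then have "poly p x = coeff p 0"
      by (simp add: poly_altdef)
    then show False
      using p mult_t_neq_1 by metis
  qed
  \<comment> \<open>The degree is below \<open>?n\<close> because the sum starts at
    \<open>1\<close>; the truncated subtraction \<open>?n - i\<close> is exact because
    \<open>degree q \<le> degree p\<close>.\<close>
  define s where "s = (\<Sum>i=1..?m. monom (t * u * coeff q i) (?n - i))"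
  have sV: "coeff s i \<in> V" for i
    unfolding s_def coeff_sum coeff_monom using u(1) t_in q(1) V(3,5)
    by (intro is_subring_sum[OF subring]) simp
  have s_deg: "coeff s i = 0" if "i \<ge> ?n" for i
    unfolding s_def coeff_sum coeff_monom using that \<open>?n > 0\<close> by (intro sum.neutral) auto
  have "poly q y = coeff q 0 + (\<Sum>i=1..?m. coeff q i * y ^ i)"
    unfolding poly_altdef atMost_atLeast0 by (simp add: sum.atLeast_Suc_atMost)
  then have "1 - t * coeff q 0 = t * (\<Sum>i=1..?m. coeff q i * y ^ i)"
    using q(2) by (simp add: algebra_simps)
  then have "1 = (\<Sum>i=1..?m. t * u * coeff q i * y ^ i)"
    using u(2) by (simp add: sum_distrib_left mult.assoc mult.left_commute)
  then have "x ^ ?n = (\<Sum>i=1..?m. x ^ ?n * (t * u * coeff q i * y ^ i))"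
    by (metis mult.right_neutral sum_distrib_left)
  also have "\<dots> = poly s x"
    unfolding s_def poly_sum poly_monom
  proof (rule sum.cong)
    fix i assume "i \<in> {1..?m}"
    then have "x ^ ?n = x ^ (?n - i) * x ^ i"
      using \<open>?m \<le> ?n\<close> by (simp flip: power_add)
    moreover have "x ^ i * y ^ i = 1"
      using \<open>x * y = 1\<close> by (simp flip: power_mult_distrib)
    ultimately show "x ^ ?n * (t * u * coeff q i * y ^ i) = t * u * coeff q i * x ^ (?n - i)"
      by (simp add: mult.assoc mult.left_commute)
  qed simp
  finally have sx: "poly s x = x ^ ?n" ..
  let ?c = "coeff p ?n"
  let ?p = "p - monom ?c ?n + smult ?c s"
  have "coeff ?p i \<in> V" for i
    using p(1) sV V by simp
  moreover have "t * poly ?p x = 1"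
    using p(2) by (simp add: sx poly_monom)
  moreover have "degree ?p < ?n"
    using \<open>?n > 0\<close> s_deg by (intro degree_lessI) (auto simp: coeff_eq_0)
  ultimately show ?thesis
    by blast
qed

text \<open>If neither \<open>x\<close> nor its inverse lies in \<open>V\<close>, relations of least
  degree exist for both, and the one of larger degree can be shortened by means of the
  other.\<close>

lemma valuation_ring:
  assumes "x \<notin> V"
  shows "inverse x \<in> V"
proof (rule ccontr)
  assume y: "inverse x \<notin> V"
  have xy: "x * inverse x = 1" "inverse x * x = 1"
    using assms V(5) by (metis right_inverse mult.commute)+
  let ?D = "\<lambda>z p. (\<forall>i. coeff p i \<in> V) \<and> t * poly p z = 1"
  have min: "\<exists>p. ?D z p \<and> (\<forall>p'. ?D z p' \<longrightarrow> degree p \<le> degree p')" if z: "z \<notin> V" for z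
  proof -
    obtain p where "?D z p"
      using inverse_t_in_adjoin[OF z] by blast
    then show ?thesis
      by (rule ex_has_least_nat[of "?D z"])
  qed
  obtain p where p: "\<forall>i. coeff p i \<in> V" "t * poly p x = 1"
    "\<forall>p'. ?D x p' \<longrightarrow> degree p \<le> degree p'"
    using min[OF assms] by blast
  obtain q where q: "\<forall>i. coeff q i \<in> V" "t * poly q (inverse x) = 1"
    "\<forall>q'. ?D (inverse x) q' \<longrightarrow> degree q \<le> degree q'"
    using min[OF y] by blast
  show False
  proof (cases "degree q \<le> degree p")
    case True
    then show ?thesis
      using reduce_degree[OF xy(1) p(1,2) q(1,2)] p(3) by (meson not_less)
  next
    case False
    then have "degree p \<le> degree q"
      by simp
    then show ?thesis
      using reduce_degree[OF xy(2) q(1,2) p(1,2)] q(3) by (meson not_less)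
  qed
qed

end

subsection \<open>Transcendental elements\<close>

definition transcendental_over :: "'a::comm_ring_1 set \<Rightarrow> 'a \<Rightarrow> bool" where
  "transcendental_over R t \<longleftrightarrow> (\<forall>p. (\<forall>i. coeff p i \<in> R) \<and> poly p t = 0 \<longrightarrow> p = 0)"

lemma transcendental_overD:
  "transcendental_over R t \<Longrightarrow> (\<And>i. coeff p i \<in> R) \<Longrightarrow> poly p t = 0 \<Longrightarrow> p = 0"
  unfolding transcendental_over_def by blast

lemma coeffs_subset_iff: "0 \<in> R \<Longrightarrow> set (coeffs p) \<subseteq> R \<longleftrightarrow> (\<forall>i. coeff p i \<in> R)"
proof -
  assume "0 \<in> R"
  then have "set (coeffs p) \<subseteq> R \<longleftrightarrow> range (coeff p) \<subseteq> R"
    by (simp add: range_coeff)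
  then show ?thesis
    by blast
qed

lemma is_subring_Ints: "is_subring (\<int> :: 'a::ring_1 set)"
  by (simp add: is_subring_def)

text \<open>There are only countably many polynomials over \<open>\<int>\<close>, the image of the
  integers in the field, and the nonzero ones have finitely many roots each.\<close>

lemma exists_transcendental:
  assumes "uncountable (UNIV :: 'a::field set)"
  obtains t :: "'a::field" where "transcendental_over \<int> t"
proof -
  let ?A = "{p :: 'a poly. p \<noteq> 0 \<and> (\<forall>i. coeff p i \<in> \<int>)}"
  have "countable (\<int> :: 'a set)"
    unfolding Ints_def by (rule countable_image) simp
  then have "countable (Poly ` lists (\<int> :: 'a set))"
    by (intro countable_image countable_lists)
  moreover have "?A \<subseteq> Poly ` lists \<int>"
  proof
    fix p :: "'a poly" assume "p \<in> ?A"
    then have "set (coeffs p) \<subseteq> \<int>"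
      by (simp add: coeffs_subset_iff)
    then have "coeffs p \<in> lists \<int>"
      by auto
    then show "p \<in> Poly ` lists \<int>"
      by (metis Poly_coeffs imageI)
  qed
  ultimately have "countable ?A"
    by (rule countable_subset[rotated])
  then have "countable (\<Union>p\<in>?A. {x. poly p x = 0})"
    by (intro countable_UN) (auto intro: countable_finite poly_roots_finite)
  then have "(\<Union>p\<in>?A. {x. poly p x = 0}) \<noteq> UNIV"
    using assms by metis
  then obtain t :: 'a where "t \<notin> (\<Union>p\<in>?A. {x. poly p x = 0})"
    by blast
  then show thesis
    by (intro that[of t]) (auto simp: transcendental_over_def)
qed

text \<open>If \<open>F\<close> is maximal among the subrings over which \<open>t\<close> is transcendental, then \<open>F\<close> is a field
  over whose extension by \<open>t\<close> everything is algebraic.\<close>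

locale maximal_transcendental =
  fixes F :: "'a::field set" and t :: 'a
  assumes subring: "is_subring F" and transcendental: "transcendental_over F t"
    and max: "\<And>R. is_subring R \<Longrightarrow> F \<subseteq> R \<Longrightarrow> R \<noteq> F \<Longrightarrow> \<not> transcendental_over R t"
begin

lemmas F = is_subringD[OF subring]

text \<open>Clearing denominators shows that \<open>t\<close> stays transcendental over the
  localization of \<open>F\<close> at \<open>b\<close>, so maximality makes this localization equal
  to \<open>F\<close>.\<close>

lemma inverse_in:
  assumes "b \<in> F"
  shows "inverse b \<in> F"
proof (cases "b = 0")
  case True
  then show ?thesis
    using assms by simp
next
  case False
  let ?R = "{y. \<exists>n. y * b ^ n \<in> F}"
  have "transcendental_over ?R t"
    unfolding transcendental_over_def
  proof (intro allI impI, elim conjE)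
    fix p assume p: "\<forall>i. coeff p i \<in> ?R" "poly p t = 0"
    have "\<forall>y\<in>set (coeffs p). \<exists>n. y * b ^ n \<in> F"
    proof
      fix y assume "y \<in> set (coeffs p)"
      then have "y \<in> range (coeff p)"
        by (simp add: range_coeff)
      then show "\<exists>n. y * b ^ n \<in> F"
        using p(1) by auto
    qed
    then obtain N where N: "\<forall>y\<in>set (coeffs p). y * b ^ N \<in> F"
      using common_denominator[OF subring assms, of "set (coeffs p)"] by blast
    have "coeff p i \<in> insert 0 (set (coeffs p))" for i
      by (simp flip: range_coeff)
    then have "coeff (smult (b ^ N) p) i \<in> F" for i
      using N F(5) by (metis coeff_smult insertE mult.commute mult_zero_left)
    moreover have "poly (smult (b ^ N) p) t = 0"
      using p(2) by simp
    ultimately have "smult (b ^ N) p = 0"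
      by (rule transcendental_overD[OF transcendental])
    then show "p = 0"
      using False by simp
  qed
  moreover have "y * b ^ 0 \<in> F" if "y \<in> F" for y
    using that by simp
  then have "F \<subseteq> ?R"
    by blast
  ultimately have "?R = F"
    using max is_subring_localization[OF subring assms] by blast
  moreover have "inverse b * b ^ 1 \<in> F"
    using False F(1) by simp
  then have "inverse b \<in> ?R"
    by blast
  ultimately show ?thesis
    by blast
qed

text \<open>An equation \<open>1/t = p(t)\<close> would make \<open>t\<close> a root of a polynomial
  over \<open>F\<close> with constant coefficient \<open>-1\<close>.\<close>

lemma inverse_t_notin_adjoin: "inverse t \<notin> adjoin F t"
proof
  assume "inverse t \<in> adjoin F t"
  then obtain p where p: "inverse t = poly p t" "\<forall>i. coeff p i \<in> F"
    by (auto simp: adjoin_def)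
  have "t \<noteq> 0"
  proof
    assume "t = 0"
    have "coeff [:0, 1:] i \<in> F" for i
      using F(1,5) by (simp add: coeff_pCons split: nat.split)
    then show False
      using transcendental_overD[OF transcendental, of "[:0, 1:]"] \<open>t = 0\<close> by simp
  qed
  have "coeff (pCons (-1) p) i \<in> F" for i
    using p(2) F(1,4) by (simp add: coeff_pCons split: nat.split)
  moreover have "poly (pCons (-1) p) t = 0"
    using \<open>t \<noteq> 0\<close> by (simp flip: p(1))
  ultimately have "pCons (-1) p = 0"
    by (rule transcendental_overD[OF transcendental])
  then show False
    by simp
qed

end

locale maximal_transcendental_avoiding = maximal_transcendental F t + V: maximal_avoiding_inverse V t
  for F V :: "'a::field set" and t :: 'a +
  assumes F_subset: "F \<subseteq> V"
begin

text \<open>A nonzero element \<open>z\<close> divisible by all powers of \<open>t\<close> is algebraic over \<open>F[t]\<close>, hence divides a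
  nonzero \<open>g(t) = t\<^sup>k (c + t h(t))\<close> with \<open>c \<noteq> 0\<close>; so \<open>t\<^sup>k\<^sup>+\<^sup>1\<close> divides \<open>g(t)\<close> and \<open>t\<close> divides the unit \<open>c\<close>.\<close>

lemma not_infinitely_divisible_poly:
  assumes g: "\<forall>i. coeff g i \<in> F" "g \<noteq> 0" and div: "\<And>n. poly g t * inverse t ^ n \<in> V"
  shows False
proof -
  \<comment> \<open>The order of vanishing of \<open>g\<close> at \<open>0\<close>.\<close>
  define k where "k = (LEAST k. coeff g k \<noteq> 0)"
  have "\<exists>k. coeff g k \<noteq> 0"
    using g(2) by (metis leading_coeff_0_iff)
  then have k: "coeff g k \<noteq> 0"
    unfolding k_def by (rule LeastI_ex)
  have less_k: "coeff g j = 0" if "j < k" for j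
    using not_less_Least[of j "\<lambda>k. coeff g k \<noteq> 0"] that unfolding k_def by blast
  let ?h = "poly_shift k g"
  let ?c = "coeff g k" and ?r = "poly (poly_shift 1 ?h) t"
  have "poly g t = t ^ k * (?c + t * ?r)"
    using poly_eq_power_mult_poly_shift[of k g t] less_k poly_eq_coeff_0_plus[of ?h t]
    by (simp add: coeff_poly_shift)
  then have "poly g t * inverse t ^ Suc k = ?c * inverse t + ?r"
    using V.t_nonzero by (simp add: field_simps)
  moreover have "adjoin F t \<subseteq> V"
    using adjoin_subset[OF V.subring F_subset V.t_in] .
  then have "?r \<in> V"
    using adjoinI[of "poly_shift 1 ?h" F t] g(1) by (auto simp: coeff_poly_shift)
  ultimately have "?c * inverse t \<in> V"
    using div[of "Suc k"] V.V(6)[of "?c * inverse t + ?r" ?r] by simp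
  then have "inverse ?c * (?c * inverse t) \<in> V"
    using V.V(3) inverse_in g(1) F_subset by blast
  then show False
    using V.t_inv k by (simp flip: mult.assoc)
qed

lemma not_infinitely_divisible:
  assumes "z \<noteq> 0" and div: "\<And>n. z * inverse t ^ n \<in> V"
  shows False
proof (cases "z \<in> F")
  case True
  have "coeff [:z:] i \<in> F" for i
    using True F(5) by (simp add: coeff_pCons split: nat.split)
  then show ?thesis
    using not_infinitely_divisible_poly[of "[:z:]"] assms by simp
next
  case False
  have zV: "z \<in> V"
    using div[of 0] by simp
  have FV: "adjoin F x \<subseteq> V" if "x \<in> V" for x
    using adjoin_subset[OF V.subring F_subset that] .
  \<comment> \<open>By maximality of \<open>F\<close>, adjoining \<open>z\<close> destroys the
    transcendence of \<open>t\<close>; the resulting relation \<open>p\<close> has coefficients in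
    \<open>F[z]\<close>, written below as values of \<open>q i\<close> at \<open>z\<close>.\<close>
  have "\<not> transcendental_over (adjoin F z) t"
    using max[OF is_subring_adjoin[OF subring]] adjoin_base[OF subring, of z] False by blast
  then obtain p where p: "p \<noteq> 0" "poly p t = 0" "\<forall>i. coeff p i \<in> adjoin F z"
    unfolding transcendental_over_def by blast
  have "\<forall>i. \<exists>q. coeff p i = poly q z \<and> (\<forall>j. coeff q j \<in> F)"
    using p(3) by (auto simp: adjoin_def)
  then obtain q where q: "\<And>i. coeff p i = poly (q i) z" "\<And>i j. coeff (q i) j \<in> F"
    by metis
  let ?N = "degree p"
  \<comment> \<open>The largest exponent for which the power of the variable divides all
    \<open>q i\<close>. Once \<open>z ^ k\<close> is cancelled, the constant terms
    \<open>coeff (q i) k\<close> form a nonzero polynomial \<open>g\<close> over \<open>F\<close>,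
    and \<open>g(t)\<close> is a multiple of \<open>z\<close> in \<open>V\<close>.\<close>
  define k where "k = (LEAST k. \<exists>i\<le>?N. coeff (q i) k \<noteq> 0)"
  have "q ?N \<noteq> 0"
    using q(1)[of ?N] p(1) by auto
  then have "\<exists>k. \<exists>i\<le>?N. coeff (q i) k \<noteq> 0"
    by (metis leading_coeff_0_iff order_refl)
  then have "\<exists>i\<le>?N. coeff (q i) k \<noteq> 0"
    unfolding k_def by (rule LeastI_ex)
  then obtain i0 where i0: "i0 \<le> ?N" "coeff (q i0) k \<noteq> 0"
    by blast
  have k: "coeff (q i) j = 0" if "i \<le> ?N" "j < k" for i j
    using that not_less_Least unfolding k_def by blast
  define r where "r i = poly (poly_shift 1 (poly_shift k (q i))) z" for i
  have r: "r i \<in> V" for i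
    unfolding r_def using FV[OF zV] q(2) adjoinI[of "poly_shift 1 (poly_shift k (q i))" F z]
    by (auto simp: coeff_poly_shift)
  have qz: "poly (q i) z = z ^ k * (coeff (q i) k + z * r i)" if "i \<le> ?N" for i
    using poly_eq_power_mult_poly_shift[of k "q i" z] poly_eq_coeff_0_plus[of "poly_shift k (q i)" z]
      k[OF that] by (simp add: r_def coeff_poly_shift)
  define g where "g = (\<Sum>i\<le>?N. monom (coeff (q i) k) i)"
  have "0 = (\<Sum>i\<le>?N. coeff p i * t ^ i)"
    using p(2) by (simp add: poly_altdef)
  also have "\<dots> = (\<Sum>i\<le>?N. z ^ k * (coeff (q i) k * t ^ i + z * (r i * t ^ i)))"
    by (intro sum.cong refl) (simp add: q(1) qz algebra_simps)
  also have "\<dots> = z ^ k * (poly g t + z * (\<Sum>i\<le>?N. r i * t ^ i))"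
    by (simp add: g_def poly_sum poly_monom sum.distrib flip: sum_distrib_left)
  finally have "poly g t = - z * (\<Sum>i\<le>?N. r i * t ^ i)"
    using assms(1) by (simp add: eq_neg_iff_add_eq_0)
  then have "poly g t * inverse t ^ n = - (z * inverse t ^ n) * (\<Sum>i\<le>?N. r i * t ^ i)" for n
    by simp
  moreover have "(\<Sum>i\<le>?N. r i * t ^ i) \<in> V"
    by (intro is_subring_sum[OF V.subring] V.V(3) r is_subring_power[OF V.subring] V.t_in)
  ultimately have "poly g t * inverse t ^ n \<in> V" for n
    using V.V(3,4) div by metis
  moreover have coeff_g: "coeff g i = (if i \<le> ?N then coeff (q i) k else 0)" for i
    unfolding g_def coeff_sum coeff_monom by simp
  then have "\<forall>i. coeff g i \<in> F"
    using q(2) F(5) by simp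
  moreover have "coeff g i0 \<noteq> 0"
    using coeff_g i0 by simp
  then have "g \<noteq> 0"
    by auto
  ultimately show False
    using not_infinitely_divisible_poly by blast
qed

text \<open>A strictly larger subring contains \<open>1/t\<close>. For \<open>x \<notin> V\<close>
  some \<open>inverse x * inverse t ^ n\<close> lies outside \<open>V\<close> by
  \<open>not_infinitely_divisible\<close>, so \<open>x * t ^ n\<close> lies in the valuation ring
  \<open>V\<close>, and division by \<open>t ^ n\<close> recovers \<open>x\<close>.\<close>

lemma maximal_subring: "is_maximal_subring V"
  unfolding is_maximal_subring_def
proof (intro conjI allI impI)
  show "V \<noteq> UNIV"
    using V.t_inv by blast
  fix R assume R: "is_subring R \<and> V \<subseteq> R"
  note Rs = is_subringD[OF conjunct1[OF R]]
  show "R = V \<or> R = UNIV"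
  proof (rule disjCI)
    assume "R \<noteq> UNIV"
    show "R = V"
    proof (rule ccontr)
      assume "R \<noteq> V"
      then have t: "inverse t \<in> R"
        using V.max R by blast
      have "x \<in> R" for x
      proof (cases "x \<in> V")
        case False
        then have "inverse x \<noteq> 0"
          using V.V(5) by auto
        then obtain n where n: "inverse x * inverse t ^ n \<notin> V"
          using not_infinitely_divisible by blast
        have "x * t ^ n \<in> V"
          using V.valuation_ring[OF n] by (simp add: power_inverse)
        then have "x * t ^ n * inverse t ^ n \<in> R"
          using R Rs(3) is_subring_power[OF conjunct1[OF R] t] by blast
        then show ?thesis
          using V.t_nonzero by (simp add: mult.assoc flip: power_mult_distrib)
      qed (use R in blast)
      then show False
        using \<open>R \<noteq> UNIV\<close> by blast
    qed
  qed
qed (rule V.subring)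

end

lemma uncountable_field_maximal_subring:
  assumes "uncountable (UNIV :: 'a::field set)"
  shows "has_maximal_subring TYPE('a)"
proof -
  obtain t :: 'a where t: "transcendental_over \<int> t"
    using exists_transcendental[OF assms] .
  \<comment> \<open>Transcendence over a subring means that it includes no coefficient set of a
    nonzero polynomial vanishing at \<open>t\<close>, which is the form that
    \<open>Zorn_avoiding\<close> requires.\<close>
  define \<X> where "\<X> = {set (coeffs p) | p. p \<noteq> 0 \<and> poly p t = 0}"
  have trans: "transcendental_over R t \<longleftrightarrow> (\<forall>X\<in>\<X>. \<not> X \<subseteq> R)" if "is_subring R" for R
    unfolding transcendental_over_def \<X>_def coeffs_subset_iff[OF is_subringD(5)[OF that], symmetric] by auto
  have av: "\<not> X \<subseteq> \<int>" if "X \<in> \<X>" for X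
    using t trans[OF is_subring_Ints] that by blast
  have fin: "finite X" if "X \<in> \<X>" for X
    using that unfolding \<X>_def by auto
  obtain F where F: "is_subring F" "\<int> \<subseteq> F" "\<forall>X\<in>\<X>. \<not> X \<subseteq> F"
    "\<forall>R. is_subring R \<and> F \<subset> R \<longrightarrow> (\<exists>X\<in>\<X>. X \<subseteq> R)"
    by (rule Zorn_avoiding[where P = is_subring, OF _ fin is_subring_Ints av])
      (rule is_subring_Union_chain)
  interpret F: maximal_transcendental F t
  proof
    show "transcendental_over F t"
      using F(1,3) trans by blast
    show "\<not> transcendental_over R t" if "is_subring R" "F \<subseteq> R" "R \<noteq> F" for R
      using F(4) trans[OF that(1)] that by blast
  qed (rule F(1))
  have av: "\<not> X \<subseteq> adjoin F t" and fin: "finite X" if "X \<in> {{inverse t}}" for X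
    using F.inverse_t_notin_adjoin that by auto
  \<comment> \<open>The second use of Zorn's lemma starts from \<open>F[t]\<close> and avoids only
    \<open>1/t\<close>.\<close>
  obtain V where V: "is_subring V" "adjoin F t \<subseteq> V" "\<forall>X\<in>{{inverse t}}. \<not> X \<subseteq> V"
    "\<forall>R. is_subring R \<and> V \<subset> R \<longrightarrow> (\<exists>X\<in>{{inverse t}}. X \<subseteq> R)"
    by (rule Zorn_avoiding[where P = is_subring, OF _ fin is_subring_adjoin[OF F(1)] av])
      (rule is_subring_Union_chain)
  interpret maximal_transcendental_avoiding F V t
  proof
    show "t \<in> V" "F \<subseteq> V"
      using adjoin_base[OF F(1), of t] V(2) by blast+
    show "inverse t \<notin> V"
      using V(3) by simp
    show "inverse t \<in> R" if "is_subring R" "V \<subseteq> R" "R \<noteq> V" for R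
      using V(4) that by blast
  qed (rule V(1))
  show ?thesis
    using maximal_subring by (rule has_maximal_subringI)
qed

section \<open>Quotients by a maximal ideal\<close>

text \<open>A type cannot depend on an ideal that is only obtained inside a proof. The ideal is therefore
  chosen globally, as one with the unwanted property whenever there is such an ideal.\<close>

definition preferred :: "('b \<Rightarrow> bool) \<Rightarrow> ('b \<Rightarrow> bool) \<Rightarrow> 'b" where
  "preferred A Q = (SOME x. A x \<and> ((\<exists>y. A y \<and> Q y) \<longrightarrow> Q x))"

lemma preferred:
  assumes "\<exists>x. A x"
  shows "A (preferred A Q)" "A y \<Longrightarrow> Q y \<Longrightarrow> Q (preferred A Q)"
proof -
  have "A (preferred A Q) \<and> ((\<exists>y. A y \<and> Q y) \<longrightarrow> Q (preferred A Q))"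
    unfolding preferred_def by (rule someI_ex) (use assms in blast)
  then show "A (preferred A Q)" "A y \<Longrightarrow> Q y \<Longrightarrow> Q (preferred A Q)"
    by blast+
qed

lemma exists_maximal_ideal_in:
  assumes C: "is_subring C"
  shows "\<exists>m. maximal_ideal_in C m"
proof -
  note Cs = is_subringD[OF C]
  have ideal_0: "ideal_in C {0}"
    using Cs(5) by (simp add: ideal_in_def)
  have av: "\<not> X \<subseteq> {0}" and fin: "finite X" if "X \<in> {{1 :: 'a}}" for X
    using that by auto
  obtain m where m: "ideal_in C m" "{0} \<subseteq> m" "\<forall>X\<in>{{1}}. \<not> X \<subseteq> m"
    "\<forall>J. ideal_in C J \<and> m \<subset> J \<longrightarrow> (\<exists>X\<in>{{1}}. X \<subseteq> J)"
    by (rule Zorn_avoiding[where P = "ideal_in C", OF _ fin ideal_0 av]) (rule ideal_in_Union_chain)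
  have "J = C" if "ideal_in C J" "m \<subset> J" for J
  proof -
    have "1 \<in> J"
      using m(4) that by blast
    then have "x \<in> J" if "x \<in> C" for x
      using ideal_inD(6)[OF \<open>ideal_in C J\<close> that, of 1] by simp
    then show ?thesis
      using ideal_inD(1)[OF that(1)] by blast
  qed
  moreover have "m \<noteq> C"
    using m(3) Cs(1) by auto
  ultimately have "maximal_ideal_in C m"
    using m(1) unfolding maximal_ideal_in_def by blast
  then show ?thesis
    by blast
qed

lemma maximal_ideal_inD:
  assumes "maximal_ideal_in S M"
  shows "ideal_in S M" "M \<noteq> S"
  using assms by (simp_all add: maximal_ideal_in_def)

lemma is_subring_UNIV: "is_subring UNIV"
  by (simp add: is_subring_def)

text \<open>One with noncommutative quotient if there is any, and an arbitrary maximal ideal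
  otherwise; the quotient is a simple ring in either case.\<close>

definition noncommutative_ideal :: "'a::ring_1 set" where
  "noncommutative_ideal = preferred (maximal_ideal_in UNIV) (\<lambda>M. \<exists>x y. x * y - y * x \<notin> M)"

lemma noncommutative_ideal:
  "maximal_ideal_in UNIV (noncommutative_ideal :: 'a::ring_1 set)"
  "maximal_ideal_in UNIV (M :: 'a set) \<Longrightarrow> x * y - y * x \<notin> M \<Longrightarrow>
    \<exists>x y :: 'a. x * y - y * x \<notin> noncommutative_ideal"
proof -
  show "maximal_ideal_in UNIV (noncommutative_ideal :: 'a set)"
    unfolding noncommutative_ideal_def
    by (rule preferred(1)[OF exists_maximal_ideal_in[OF is_subring_UNIV]])
  assume M: "maximal_ideal_in UNIV M" "x * y - y * x \<notin> M"
  then have "\<exists>x y. x * y - y * x \<notin> M"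
    by blast
  then show "\<exists>x y :: 'a. x * y - y * x \<notin> noncommutative_ideal"
    unfolding noncommutative_ideal_def
    by (rule preferred(2)[OF exists_maximal_ideal_in[OF is_subring_UNIV] M(1)])
qed

lemma ideal_in_noncommutative_ideal: "ideal_in UNIV noncommutative_ideal"
  by (rule maximal_ideal_inD(1)[OF noncommutative_ideal(1)])

lemmas noncommutative_idealD = ideal_inD[OF ideal_in_noncommutative_ideal]

\<comment> \<open>The simple quotient ring\<close>
quotient_type (overloaded) 'a simple_quotient = "'a::ring_1" /
  "\<lambda>x y :: 'a::ring_1. x - y \<in> noncommutative_ideal"
proof (rule equivpI)
  show "reflp (\<lambda>x y :: 'a. x - y \<in> noncommutative_ideal)"
    by (simp add: reflp_def noncommutative_idealD)
  show "symp (\<lambda>x y :: 'a. x - y \<in> noncommutative_ideal)"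
    unfolding symp_def using noncommutative_idealD(4) by (metis minus_diff_eq)
  show "transp (\<lambda>x y :: 'a. x - y \<in> noncommutative_ideal)"
    unfolding transp_def using noncommutative_idealD(3) by (metis diff_add_cancel add_diff_eq)
qed

instantiation simple_quotient :: (ring_1) ring_1
begin

lift_definition zero_simple_quotient :: "'a simple_quotient" is 0 .
lift_definition one_simple_quotient :: "'a simple_quotient" is 1 .

lift_definition plus_simple_quotient :: "'a simple_quotient \<Rightarrow> 'a simple_quotient \<Rightarrow> 'a simple_quotient"
  is "(+)"
  using noncommutative_idealD(3) by (metis add_diff_add)

lift_definition uminus_simple_quotient :: "'a simple_quotient \<Rightarrow> 'a simple_quotient"
  is uminus
  using noncommutative_idealD(4) by (metis minus_diff_minus)

lift_definition minus_simple_quotient :: "'a simple_quotient \<Rightarrow> 'a simple_quotient \<Rightarrow> 'a simple_quotient"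
  is "(-)"
proof -
  fix x x' y y' :: 'a assume "x - x' \<in> noncommutative_ideal" "y - y' \<in> noncommutative_ideal"
  then have "(x - x') - (y - y') \<in> noncommutative_ideal"
    by (rule noncommutative_idealD(5))
  then show "(x - y) - (x' - y') \<in> noncommutative_ideal"
    by (simp add: algebra_simps)
qed

lift_definition times_simple_quotient :: "'a simple_quotient \<Rightarrow> 'a simple_quotient \<Rightarrow> 'a simple_quotient"
  is "(*)"
proof -
  fix x x' y y' :: 'a assume "x - x' \<in> noncommutative_ideal" "y - y' \<in> noncommutative_ideal"
  then have "(x - x') * y + x' * (y - y') \<in> noncommutative_ideal"
    by (intro noncommutative_idealD(3) noncommutative_idealD(6,7)[OF UNIV_I])
  then show "x * y - x' * y' \<in> noncommutative_ideal"
    by (simp add: algebra_simps)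
qed

instance
proof
  fix a b c :: "'a simple_quotient"
  show "a + b + c = a + (b + c)"
    by transfer (simp add: add.assoc noncommutative_idealD(2))
  show "a + b = b + a"
    by transfer (simp add: add.commute noncommutative_idealD(2))
  show "0 + a = a"
    by transfer (simp add: noncommutative_idealD(2))
  show "- a + a = 0"
    by transfer (simp add: noncommutative_idealD(2))
  show "a - b = a + - b"
    by transfer (simp add: noncommutative_idealD(2))
  show "a * b * c = a * (b * c)"
    by transfer (simp add: mult.assoc noncommutative_idealD(2))
  show "1 * a = a"
    by transfer (simp add: noncommutative_idealD(2))
  show "a * 1 = a"
    by transfer (simp add: noncommutative_idealD(2))
  show "(a + b) * c = a * c + b * c"
    by transfer (simp add: distrib_right noncommutative_idealD(2))
  show "a * (b + c) = a * b + a * c"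
    by transfer (simp add: distrib_left noncommutative_idealD(2))
  show "(0 :: 'a simple_quotient) \<noteq> 1"
  proof transfer
    have "noncommutative_ideal \<noteq> (UNIV :: 'a set)"
      by (rule maximal_ideal_inD(2)[OF noncommutative_ideal(1)])
    then have "(1 :: 'a) \<notin> noncommutative_ideal"
      using ideal_in_UNIV_eq[OF ideal_in_noncommutative_ideal] by blast
    then show "(0 :: 'a) - 1 \<notin> noncommutative_ideal"
      using noncommutative_idealD(4)[of "0 - 1 :: 'a"] by auto
  qed
qed

end

abbreviation to_simple :: "'a::ring_1 \<Rightarrow> 'a simple_quotient" where
  "to_simple \<equiv> abs_simple_quotient"

lemma to_simple_eq_iff: "to_simple x = to_simple y \<longleftrightarrow> x - y \<in> noncommutative_ideal"
  by (rule simple_quotient.abs_eq_iff)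

lemma to_simple_hom:
  "to_simple (x + y) = to_simple x + to_simple y" "to_simple (x * y) = to_simple x * to_simple y"
  "to_simple 1 = 1" "to_simple 0 = 0" "to_simple (- x) = - to_simple x"
  by (simp_all add: plus_simple_quotient.abs_eq times_simple_quotient.abs_eq
      one_simple_quotient.abs_eq zero_simple_quotient.abs_eq uminus_simple_quotient.abs_eq)

lemma to_simple_power: "to_simple (x ^ n) = to_simple x ^ n"
  by (induction n) (simp_all add: to_simple_hom)

lemma to_simple_sum: "to_simple (sum f I) = (\<Sum>i\<in>I. to_simple (f i))"
  by (induction I rule: infinite_finite_induct) (simp_all add: to_simple_hom)

lemma to_simple_surj: "surj to_simple"
  by (metis surjI Quotient3_simple_quotient Quotient3_abs_rep)

lemma simple_ring_simple_quotient: "simple_ring TYPE('a::ring_1 simple_quotient)"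
  unfolding simple_ring_def
proof (intro allI impI)
  fix I :: "'a simple_quotient set" assume I: "ideal_in UNIV I"
  let ?J = "to_simple -` I"
  have "ideal_in UNIV ?J"
    unfolding ideal_in_def
    using ideal_inD(2-4)[OF I] ideal_inD(6,7)[OF I UNIV_I] by (simp add: to_simple_hom)
  moreover have "noncommutative_ideal \<subseteq> ?J"
  proof
    fix x :: 'a assume "x \<in> noncommutative_ideal"
    then have "to_simple x = to_simple 0"
      by (simp add: to_simple_eq_iff)
    then show "x \<in> ?J"
      using ideal_inD(2)[OF I] by (simp add: to_simple_hom)
  qed
  ultimately have "?J = noncommutative_ideal \<or> ?J = UNIV"
    using noncommutative_ideal(1) unfolding maximal_ideal_in_def by blast
  then show "I = {0} \<or> I = UNIV"
  proof
    assume J: "?J = noncommutative_ideal"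
    have "y = 0" if "y \<in> I" for y
    proof -
      obtain x where x: "y = to_simple x"
        using to_simple_surj by (metis surjD)
      then have "x - 0 \<in> noncommutative_ideal"
        using that J by auto
      then show ?thesis
        using x by (metis to_simple_eq_iff to_simple_hom(4))
    qed
    then show ?thesis
      using ideal_inD(2)[OF I] by blast
  next
    assume "?J = UNIV"
    then have "I = UNIV"
      using surj_image_vimage_eq[OF to_simple_surj, of I] to_simple_surj by metis
    then show ?thesis ..
  qed
qed

lemma integral_over_simple_quotient:
  assumes "integral_over (center :: 'a::ring_1 set)"
  shows "integral_over (center :: 'a simple_quotient set)"
  unfolding integral_over_def
proof
  fix y :: "'a simple_quotient"
  obtain x where x: "y = to_simple x"
    using to_simple_surj by (metis surjD)
  obtain n c where c: "\<forall>i<n. c i \<in> (center :: 'a set)" "x ^ n + (\<Sum>i<n. c i * x ^ i) = 0"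
    using assms unfolding integral_over_def by blast
  have "to_simple (c i) \<in> center" if "i < n" for i
  proof -
    have "to_simple (c i) * to_simple z = to_simple z * to_simple (c i)" for z
      using centerD[of "c i" z] c(1) that by (metis to_simple_hom(2))
    then have "to_simple (c i) * z = z * to_simple (c i)" for z
      using to_simple_surj by (metis surjD)
    then show ?thesis
      unfolding center_def by blast
  qed
  moreover have "y ^ n + (\<Sum>i<n. to_simple (c i) * y ^ i) = 0"
    using arg_cong[OF c(2), of to_simple] unfolding x
    by (simp add: to_simple_hom to_simple_power to_simple_sum)
  ultimately show "\<exists>n c. (\<forall>i<n. c i \<in> center) \<and> y ^ n + (\<Sum>i<n. c i * y ^ i) = 0"
    by (intro exI[of _ n] exI[of _ "\<lambda>i. to_simple (c i)"]) blast
qed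

text \<open>A nonzero commutator lies outside some maximal ideal, so the quotient by
  \<open>noncommutative_ideal\<close> is noncommutative. Being simple and integral over its center,
  this quotient has a maximal subring, whose preimage is a maximal subring of the ring.\<close>

lemma commutative_if_no_maximal_subring:
  fixes x y :: "'a::ring_1"
  assumes red: "reduced_ring TYPE('a)" and int: "integral_over (center :: 'a set)"
    and hil: "hilbert_on (center :: 'a set)" and nomax: "\<not> has_maximal_subring TYPE('a)"
  shows "x * y = y * x"
proof (rule ccontr)
  assume "x * y \<noteq> y * x"
  then obtain M where "maximal_ideal_in UNIV M" "x * y - y * x \<notin> M"
    using exists_maximal_ideal_avoiding[OF red int hil, of "x * y - y * x"] by auto
  then obtain a b :: 'a where "a * b - b * a \<notin> noncommutative_ideal"
    using noncommutative_ideal(2) by blast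
  then have "to_simple a * to_simple b \<noteq> to_simple b * to_simple a"
    by (simp add: to_simple_eq_iff flip: to_simple_hom(2))
  then have "has_maximal_subring TYPE('a simple_quotient)"
    using simple_integral_commutative[OF simple_ring_simple_quotient integral_over_simple_quotient[OF int]]
    by blast
  then show False
    using nomax maximal_subring_vimage[of to_simple] to_simple_hom to_simple_surj by blast
qed

text \<open>\<open>h\<close> induces an injection of the quotient into the naturals; this form needs
  no type for the quotient.\<close>

definition countable_modulo :: "'a::ring_1 set \<Rightarrow> 'a set \<Rightarrow> bool" where
  "countable_modulo C m \<longleftrightarrow> (\<exists>h :: 'a \<Rightarrow> nat. \<forall>x\<in>C. \<forall>y\<in>C. h x = h y \<longleftrightarrow> x - y \<in> m)"

text \<open>The center is used because it has maximal ideals with a field as quotient, even if the ring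
  itself has none.\<close>

definition residue_ideal :: "'a::ring_1 set" where
  "residue_ideal = preferred (maximal_ideal_in center) (\<lambda>m. \<not> countable_modulo center m)"

lemma residue_ideal:
  "maximal_ideal_in center (residue_ideal :: 'a::ring_1 set)"
  "maximal_ideal_in center (m :: 'a set) \<Longrightarrow> \<not> countable_modulo center m \<Longrightarrow>
    \<not> countable_modulo center (residue_ideal :: 'a set)"
  unfolding residue_ideal_def
  by (rule preferred(1), rule exists_maximal_ideal_in[OF is_subring_center])
    (rule preferred(2)[OF exists_maximal_ideal_in[OF is_subring_center]])

section \<open>The residue field of the center\<close>

lemma ideal_in_residue_ideal: "ideal_in center residue_ideal"
  by (rule maximal_ideal_inD(1)[OF residue_ideal(1)])

lemmas residue_idealD = ideal_inD[OF ideal_in_residue_ideal]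
lemmas centerDs = is_subringD[OF is_subring_center]

text \<open>As a partial equivalence with the center as its domain, it yields the quotient of the
  center directly, without a separate type for the center.\<close>

definition residue_rel :: "'a::ring_1 \<Rightarrow> 'a \<Rightarrow> bool" where
  "residue_rel x y \<longleftrightarrow> x \<in> center \<and> y \<in> center \<and> x - y \<in> residue_ideal"

lemma residue_rel_refl: "x \<in> center \<Longrightarrow> residue_rel x x"
  by (simp add: residue_rel_def residue_idealD(2))

quotient_type (overloaded) 'a residue = "'a::ring_1" / partial: "residue_rel :: 'a::ring_1 \<Rightarrow> _"
proof (rule part_equivpI)
  show "\<exists>x :: 'a. residue_rel x x"
    using residue_rel_refl centerDs(1) by blast
  show "symp (residue_rel :: 'a \<Rightarrow> _)"
    unfolding symp_def residue_rel_def using residue_idealD(4) by (metis minus_diff_eq)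
  show "transp (residue_rel :: 'a \<Rightarrow> _)"
    unfolding transp_def residue_rel_def using residue_idealD(3) by (metis diff_add_cancel add_diff_eq)
qed

instantiation residue :: (ring_1) comm_ring_1
begin

lift_definition zero_residue :: "'a residue" is 0
  by (intro residue_rel_refl centerDs)

lift_definition one_residue :: "'a residue" is 1
  by (intro residue_rel_refl centerDs)

lift_definition plus_residue :: "'a residue \<Rightarrow> 'a residue \<Rightarrow> 'a residue" is "(+)"
  unfolding residue_rel_def using residue_idealD(3) centerDs(2) by (metis add_diff_add)

lift_definition uminus_residue :: "'a residue \<Rightarrow> 'a residue" is uminus
  unfolding residue_rel_def using residue_idealD(4) centerDs(4) by (metis minus_diff_minus)

lift_definition minus_residue :: "'a residue \<Rightarrow> 'a residue \<Rightarrow> 'a residue" is "(-)"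
  unfolding residue_rel_def
proof (elim conjE, intro conjI)
  fix x x' y y' :: 'a assume "x - x' \<in> residue_ideal" "y - y' \<in> residue_ideal"
  then have "(x - x') - (y - y') \<in> residue_ideal"
    by (rule residue_idealD(5))
  then show "(x - y) - (x' - y') \<in> residue_ideal"
    by (simp add: algebra_simps)
qed (auto intro: centerDs(6))

lift_definition times_residue :: "'a residue \<Rightarrow> 'a residue \<Rightarrow> 'a residue" is "(*)"
  unfolding residue_rel_def
proof (elim conjE, intro conjI)
  fix x x' y y' :: 'a
  assume "x' \<in> center" "y \<in> center" "x - x' \<in> residue_ideal" "y - y' \<in> residue_ideal"
  then have "(x - x') * y + x' * (y - y') \<in> residue_ideal"
    by (intro residue_idealD(3) residue_idealD(6,7))
  then show "x * y - x' * y' \<in> residue_ideal"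
    by (simp add: algebra_simps)
qed (auto intro: centerDs(3))

instance
proof
  fix a b c :: "'a residue"
  show "a + b + c = a + (b + c)"
    by transfer (simp add: residue_rel_def add.assoc residue_idealD(2) centerDs(2))
  show "a + b = b + a"
    by transfer (simp add: residue_rel_def add.commute residue_idealD(2) centerDs(2))
  show "0 + a = a"
    by transfer simp
  show "- a + a = 0"
    by transfer (simp add: residue_rel_def residue_idealD(2) centerDs(5))
  show "a - b = a + - b"
    by transfer (simp add: residue_rel_def residue_idealD(2) centerDs(2,4,6))
  show "a * b * c = a * (b * c)"
    by transfer (simp add: residue_rel_def mult.assoc residue_idealD(2) centerDs(3))
  show "a * b = b * a"
    by transfer (simp add: residue_rel_def centerD residue_idealD(2) centerDs(3))
  show "1 * a = a"
    by transfer simp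
  show "(a + b) * c = a * c + b * c"
    by transfer (simp add: residue_rel_def distrib_right residue_idealD(2) centerDs(2,3))
  show "(0 :: 'a residue) \<noteq> 1"
  proof transfer
    have "residue_ideal \<noteq> (center :: 'a set)"
      by (rule maximal_ideal_inD(2)[OF residue_ideal(1)])
    moreover have "c \<in> residue_ideal" if "(1 :: 'a) \<in> residue_ideal" "c \<in> center" for c :: 'a
      using residue_idealD(6)[OF that(2,1)] by simp
    ultimately have "(1 :: 'a) \<notin> residue_ideal"
      using residue_idealD(1) by blast
    then show "\<not> residue_rel (0 :: 'a) 1"
      unfolding residue_rel_def using residue_idealD(4)[of "0 - 1 :: 'a"] by auto
  qed
qed

end

lemma residue_inverse:
  assumes "a \<noteq> (0 :: 'a::ring_1 residue)"
  shows "\<exists>b. a * b = 1"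
  using assms
proof transfer
  fix a :: 'a assume a: "residue_rel a a" "\<not> residue_rel a 0"
  then have "a \<in> center" "a \<notin> residue_ideal"
    by (auto simp: residue_rel_def centerDs(5))
  then obtain r where r: "r \<in> center" "1 - a * r \<in> residue_ideal"
    using maximal_ideal_in_inverse[OF is_subring_center centerD residue_ideal(1)] by blast
  have "a * r - 1 \<in> residue_ideal"
    using residue_idealD(4)[OF r(2)] by simp
  then have "residue_rel (a * r) 1"
    using \<open>a \<in> center\<close> r(1) by (simp add: residue_rel_def centerDs(1,3))
  then show "\<exists>b\<in>Collect (\<lambda>x. residue_rel x x). residue_rel (a * b) 1"
    using r(1) residue_rel_refl by blast
qed

instantiation residue :: (ring_1) field
begin

definition "inverse_residue a = (if a = (0 :: 'a residue) then 0 else SOME b. a * b = 1)"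
definition "divide_residue a b = a * inverse (b :: 'a residue)"

instance
proof
  fix a b :: "'a residue"
  show "inverse a * a = 1" if "a \<noteq> 0"
    using someI_ex[OF residue_inverse[OF that]] that by (simp add: inverse_residue_def mult.commute)
qed (simp_all add: inverse_residue_def divide_residue_def)

end

text \<open>If any maximal ideal has an uncountable quotient, then so does
  \<open>residue_ideal\<close>, by its choice. Since the center is the whole ring, the residue field
  is a quotient of the ring, and its maximal subring pulls back.\<close>

lemma countable_modulo_if_no_maximal_subring:
  fixes M :: "'a::ring_1 set"
  assumes center: "center = (UNIV :: 'a set)" and nomax: "\<not> has_maximal_subring TYPE('a)"
    and "maximal_ideal_in UNIV M"
  shows "countable_modulo UNIV M"
proof (rule ccontr)
  assume "\<not> countable_modulo UNIV M"
  then have unc: "\<not> countable_modulo UNIV (residue_ideal :: 'a set)"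
    using residue_ideal(2)[of M] assms(3) unfolding center by blast
  have rel: "residue_rel x x" for x :: 'a
    using residue_rel_refl center by blast
  let ?p = "abs_residue :: 'a \<Rightarrow> 'a residue"
  have eq_iff: "?p x = ?p y \<longleftrightarrow> x - y \<in> residue_ideal" for x y
    using Quotient3_rel[OF Quotient3_residue, of x y] rel[of x] rel[of y]
    by (simp add: residue_rel_def center)
  have "uncountable (UNIV :: 'a residue set)"
  proof
    assume "countable (UNIV :: 'a residue set)"
    then obtain g :: "'a residue \<Rightarrow> nat" where "inj g"
      by (rule countableE)
    then have "g (?p x) = g (?p y) \<longleftrightarrow> x - y \<in> residue_ideal" for x y
      by (simp add: inj_eq eq_iff)
    then show False
      using unc unfolding countable_modulo_def by (metis comp_apply)
  qed
  then have "has_maximal_subring TYPE('a residue)"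
    by (rule uncountable_field_maximal_subring)
  moreover have "?p (x + y) = ?p x + ?p y" "?p (x * y) = ?p x * ?p y" "?p 1 = 1" for x y
    using rel by (simp_all add: plus_residue.abs_eq times_residue.abs_eq one_residue.abs_eq)
  moreover have "surj ?p"
    by (metis surjI Quotient3_residue Quotient3_abs_rep)
  ultimately show False
    using nomax maximal_subring_vimage[of ?p] by blast
qed

section \<open>Distinct maximal ideals with isomorphic quotients\<close>

text \<open>The isomorphism type of a countable quotient, encoded as a set of natural numbers.\<close>

definition residue_code :: "('a::ring_1 \<Rightarrow> nat) \<Rightarrow> nat set" where
  "residue_code h = range (\<lambda>(x, y). list_encode [h 1, h x, h y, h (x + y), h (x * y)])"

text \<open>Elements with the same number under \<open>h\<close> and \<open>k\<close> correspond;
  inclusion of the codes makes this correspondence total and provides partners compatible with sums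
  and products.\<close>

lemma residue_code_subsetD:
  assumes "residue_code h \<subseteq> residue_code k"
  shows "\<exists>x' y'. h 1 = k 1 \<and> h x = k x' \<and> h y = k y' \<and> h (x + y) = k (x' + y') \<and> h (x * y) = k (x' * y')"
proof -
  have "list_encode [h 1, h x, h y, h (x + y), h (x * y)] \<in> residue_code k"
    using assms by (auto simp: residue_code_def)
  then obtain x' y' where
    "list_encode [h 1, h x, h y, h (x + y), h (x * y)] = list_encode [k 1, k x', k y', k (x' + y'), k (x' * y')]"
    by (auto simp: residue_code_def)
  then show ?thesis
    by (auto simp: list_encode_eq)
qed

text \<open>The maximal subring is the preimage of the graph of an isomorphism between the two quotients.\<close>

lemma maximal_subring_isomorphic_quotients:
  fixes M N :: "'a::ring_1 set" and h k :: "'a \<Rightarrow> nat"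
  assumes comm: "\<And>x y :: 'a. x * y = y * x"
    and M: "maximal_ideal_in UNIV M" and N: "maximal_ideal_in UNIV N" and "M \<noteq> N"
    and h: "\<And>x y. h x = h y \<longleftrightarrow> x - y \<in> M" and k: "\<And>x y. k x = k y \<longleftrightarrow> x - y \<in> N"
    and code: "residue_code h = residue_code k"
  shows "has_maximal_subring TYPE('a)"
proof -
  have MI: "ideal_in UNIV M" and NI: "ideal_in UNIV N"
    using M N by (auto simp: maximal_ideal_in_def)
  note Mi = ideal_inD[OF MI] and Ni = ideal_inD[OF NI]
  note Mm = ideal_inD(6,7)[OF MI UNIV_I] and Nm = ideal_inD(6,7)[OF NI UNIV_I]
  have hk: "\<exists>y. h x = k y" and kh: "\<exists>y. k x = h y" for x
    using residue_code_subsetD[of h k x] residue_code_subsetD[of k h x] code by blast+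
  have one: "h 1 = k 1"
    using residue_code_subsetD[of h k] code by blast
  \<comment> \<open>The code provides only some partners \<open>u\<close> and \<open>v\<close>; all
    others differ from these by elements of \<open>N\<close>, which keeps sums and products in their
    cosets.\<close>
  have hom: "h (x + y) = k (x' + y')" "h (x * y) = k (x' * y')"
    if xy: "h x = k x'" "h y = k y'" for x y x' y'
  proof -
    obtain u v where uv: "h x = k u" "h y = k v" "h (x + y) = k (u + v)" "h (x * y) = k (u * v)"
      using residue_code_subsetD[of h k x y] code by blast
    have uv': "u - x' \<in> N" "v - y' \<in> N"
      using xy uv(1,2) by (simp_all flip: k)
    have "(u - x') + (v - y') \<in> N" "(u - x') * v + x' * (v - y') \<in> N"
      using Ni(3) Nm uv' by blast+
    then have "(u + v) - (x' + y') \<in> N" "u * v - x' * y' \<in> N"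
      by (simp_all add: algebra_simps)
    then show "h (x + y) = k (x' + y')" "h (x * y) = k (x' * y')"
      using uv(3,4) by (simp_all flip: k)
  qed
  have zero: "h 0 = k 0"
  proof -
    obtain z where z: "h 0 = k z"
      using hk by blast
    then have "k (z + z) = k z"
      using hom(1)[OF z z] by simp
    then have "k z = k 0"
      by (simp add: k)
    then show ?thesis
      using z by simp
  qed
  have M_iff: "x \<in> M \<longleftrightarrow> h x = h 0" and N_iff: "x \<in> N \<longleftrightarrow> k x = k 0" for x
    by (simp_all add: h k)
  have "\<not> M \<subseteq> N"
    using M N \<open>M \<noteq> N\<close> unfolding maximal_ideal_in_def by blast
  then obtain m where m: "m \<in> M" "m \<notin> N"
    by blast
  then obtain r where "1 - m * r \<in> N"
    using maximal_ideal_in_inverse[OF is_subring_UNIV comm N] by blast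
  then obtain e where e: "e \<in> M" "1 - e \<in> N"
    using Mm(2)[OF m(1)] by blast
  \<comment> \<open>Chinese remainder theorem: \<open>e\<close> is \<open>0\<close> modulo
    \<open>M\<close> and \<open>1\<close> modulo \<open>N\<close>.\<close>
  have crt: "\<exists>s. h s = h x \<and> k s = k y" for x y
  proof -
    let ?s = "x * (1 - e) + y * e"
    have "(y - x) * e \<in> M" "(x - y) * (1 - e) \<in> N"
      using e Mm Nm by blast+
    moreover have "?s - x = (y - x) * e" "?s - y = (x - y) * (1 - e)"
      by (simp_all add: algebra_simps)
    ultimately have "h ?s = h x" "k ?s = k y"
      by (simp_all add: h k)
    then show ?thesis
      by blast
  qed
  define S where "S = {x. h x = k x}"
  have SI: "x \<in> S" if "h x = k x" for x
    using that by (simp add: S_def)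
  have "is_subring S"
    unfolding is_subring_def
  proof (intro conjI ballI)
    show "1 \<in> S"
      using one by (rule SI)
    fix x assume "x \<in> S"
    then have x: "h x = k x"
      by (simp add: S_def)
    obtain z where z: "h (- x) = k z"
      using hk by blast
    have "k (x + z) = k 0"
      using hom(1)[OF x z] zero by simp
    then have "k z = k (- x)"
      by (simp add: k add.commute)
    then show "- x \<in> S"
      using z by (intro SI) simp
    fix y assume "y \<in> S"
    then have "h y = k y"
      by (simp add: S_def)
    then show "x + y \<in> S" "x * y \<in> S"
      using hom[OF x] by (simp_all add: S_def)
  qed
  moreover have "S \<noteq> UNIV"
  proof
    assume "S = UNIV"
    then have "h x = k x" for x
      unfolding S_def by blast
    then have "x \<in> M \<longleftrightarrow> x \<in> N" for x
      unfolding M_iff N_iff by simp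
    then show False
      using \<open>M \<noteq> N\<close> by blast
  qed
  moreover have "R = UNIV" if R: "is_subring R" and SR: "S \<subseteq> R" and "R \<noteq> S" for R
  proof -
    note Rs = is_subringD[OF R]
    obtain r where r: "r \<in> R" "h r \<noteq> k r"
      using SR \<open>R \<noteq> S\<close> unfolding S_def by blast
    obtain r' where r': "k r = h r'"
      using kh by blast
    obtain s where s: "h s = h r'" "k s = k r"
      using crt by blast
    \<comment> \<open>\<open>s \<in> S\<close> agrees with \<open>r\<close> modulo \<open>N\<close>,
      so \<open>u\<close> lies in \<open>N\<close> and in \<open>R\<close>; it is not in
      \<open>M\<close>, because \<open>r \<notin> S\<close>.\<close>
    define u where "u = r - s"
    have "s \<in> S"
      using s r' by (intro SI) simp
    then have u: "u \<in> R" "u \<in> N" "u \<notin> M"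
      using r s r' SR Rs(6) by (auto simp: u_def simp flip: h k)
    then obtain v where v: "1 - u * v \<in> M"
      using maximal_ideal_in_inverse[OF is_subring_UNIV comm M] by blast
    \<comment> \<open>With \<open>s \<in> S\<close> congruent to \<open>n * v\<close> modulo
      \<open>M\<close>, the element \<open>s * u\<close> is congruent to \<open>n\<close> modulo
      \<open>M\<close>. As \<open>u\<close> and \<open>n\<close> lie in \<open>N\<close>, the
      difference lies in \<open>M \<inter> N\<close>, which is part of \<open>S\<close>.\<close>
    have NR: "n \<in> R" if "n \<in> N" for n
    proof -
      obtain t where t: "h (n * v) = k t"
        using hk by blast
      then obtain s where s: "h s = h (n * v)" "k s = k t"
        using crt by blast
      have "s \<in> S"
        using s t by (intro SI) simp
      have "n * (1 - u * v) - (s - n * v) * u \<in> M"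
        using s(1) v Mi(5) Mm by (simp add: h)
      moreover have "n * (u * v) = n * v * u"
        using comm[of u v] by (simp add: mult.assoc)
      then have "n * (1 - u * v) - (s - n * v) * u = n - s * u"
        by (simp add: right_diff_distrib left_diff_distrib)
      ultimately have "n - s * u \<in> M"
        by simp
      moreover have "n - s * u \<in> N"
        using that u(2) Ni(5) Nm by blast
      ultimately have "n - s * u \<in> S"
        using zero by (intro SI) (simp add: M_iff N_iff)
      then have "(n - s * u) + s * u \<in> R"
        using SR \<open>s \<in> S\<close> u(1) by (intro Rs(2,3)) auto
      then show ?thesis
        by simp
    qed
    \<comment> \<open>Some \<open>s \<in> S\<close> agrees with \<open>x\<close> modulo
      \<open>N\<close>, and \<open>N \<subseteq> R\<close>.\<close>
    have "x \<in> R" for x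
    proof -
      obtain y where y: "k x = h y"
        using kh by blast
      then obtain s where s: "h s = h y" "k s = k x"
        using crt by blast
      then have "s \<in> S"
        using y by (intro SI) simp
      moreover have "x - s \<in> R"
        using s(2) by (intro NR) (simp flip: k)
      ultimately have "(x - s) + s \<in> R"
        using SR Rs(2) by blast
      then show ?thesis
        by simp
    qed
    then show ?thesis
      by blast
  qed
  ultimately have "is_maximal_subring S"
    unfolding is_maximal_subring_def by metis
  then show ?thesis
    by (rule has_maximal_subringI)
qed

section \<open>The cardinality bound\<close>

lemma cardinality_bound:
  assumes comm: "\<And>x y :: 'a::ring_1. x * y = y * x" and nomax: "\<not> has_maximal_subring TYPE('a)"
    and countable: "\<And>M :: 'a set. maximal_ideal_in UNIV M \<Longrightarrow> countable_modulo UNIV M"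
    and jacobson: "\<And>x :: 'a. x \<noteq> 0 \<Longrightarrow> \<exists>M. maximal_ideal_in UNIV M \<and> x \<notin> M"
  shows "\<exists>f :: 'a \<Rightarrow> nat set set. inj f"
proof -
  have "\<exists>h :: 'a \<Rightarrow> nat. \<forall>x y. h x = h y \<longleftrightarrow> x - y \<in> M" if "maximal_ideal_in UNIV M" for M
    using countable[OF that] unfolding countable_modulo_def by simp
  then obtain H :: "'a set \<Rightarrow> 'a \<Rightarrow> nat"
    where H: "\<And>M x y. maximal_ideal_in UNIV M \<Longrightarrow> H M x = H M y \<longleftrightarrow> x - y \<in> M"
    by metis
  \<comment> \<open>This records the isomorphism type of the quotient by \<open>M\<close> together
    with the number of the coset of \<open>x\<close>. The set of these codes for all
    \<open>M\<close> is an element of \<open>nat set set\<close>, a type of cardinality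
    2^(2^aleph_0).\<close>
  define E where "E M x = sum_encode ` (residue_code (H M) <+> {H M x})" for M x
  define f where "f x = {E M x | M. maximal_ideal_in UNIV M}" for x
  have "x = y" if fxy: "f x = f y" for x y
  proof (rule ccontr)
    assume "x \<noteq> y"
    then obtain M where M: "maximal_ideal_in UNIV M" "x - y \<notin> M"
      using jacobson[of "x - y"] by auto
    have "E M x \<in> f x"
      using M(1) unfolding f_def by blast
    then have "E M x \<in> f y"
      unfolding fxy .
    then obtain N where N: "maximal_ideal_in UNIV N" and eq: "E M x = E N y"
      unfolding f_def by blast
    have "residue_code (H M) <+> {H M x} = residue_code (H N) <+> {H N y}"
      using eq unfolding E_def by (simp add: inj_image_eq_iff inj_sum_encode)
    then have *: "Inl a \<in> residue_code (H M) <+> {H M x} \<longleftrightarrow> Inl a \<in> residue_code (H N) <+> {H N y}"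
      "Inr b \<in> residue_code (H M) <+> {H M x} \<longleftrightarrow> Inr b \<in> residue_code (H N) <+> {H N y}" for a b
      by simp_all
    have "residue_code (H M) = residue_code (H N)" "H M x = H N y"
      using * by auto
    \<comment> \<open>Distinct maximal ideals with equal codes would give a maximal subring, so the
      code identifies the ideal.\<close>
    moreover from this(1) have "M = N"
      using maximal_subring_isomorphic_quotients[OF comm M(1) N _ H[OF M(1)] H[OF N]] nomax by blast
    ultimately show False
      using H[OF M(1)] M(2) by simp
  qed
  then have "inj f"
    by (rule injI)
  then show ?thesis
    by blast
qed

section \<open>Von Neumann regularity in dimension zero\<close>

lemma reduced_zero_dimensional_von_neumann_regular:
  assumes red: "reduced_ring TYPE('a::ring_1)" and comm: "\<And>x y :: 'a. x * y = y * x"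
    and dim: "zero_dimensional_on (UNIV :: 'a set)"
  shows "von_neumann_regular TYPE('a)"
  unfolding von_neumann_regular_def
proof (rule allI, rule ccontr)
  fix a :: 'a assume a: "\<nexists>x. a * x * a = a"
  \<comment> \<open>A completely prime ideal disjoint from \<open>?X\<close> is maximal by
    \<open>dim\<close> and does not contain \<open>a\<close>. Then \<open>a\<close> is invertible
    modulo it, which puts an element of \<open>?X\<close> into it.\<close>
  let ?X = "range (\<lambda>x. a * (1 - a * x))"
  have "0 \<notin> ?X"
  proof
    assume "0 \<in> ?X"
    then obtain x where "0 = a * (1 - a * x)"
      by blast
    then have "a * x * a = a"
      using comm[of "a * x" a] by (simp add: right_diff_distrib)
    then show False
      using a by blast
  qed
  have step: "?X \<inter> I \<noteq> {}" if I: "reduced_ideal I" and uv: "u \<in> ?X" "v \<in> ?X" "u * v \<in> I" for I u v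
  proof -
    obtain x y where u: "u = a * (1 - a * x)" and v: "v = a * (1 - a * y)"
      using uv by blast
    \<comment> \<open>This \<open>z\<close> makes \<open>1 - a * z\<close> the product of the two
      factors \<open>1 - a * x\<close> and \<open>1 - a * y\<close>. The square of
      \<open>a * w\<close>, an element of \<open>?X\<close>, is then a multiple of
      \<open>u * v\<close>.\<close>
    define z where "z = x + y - x * a * y"
    define w where "w = 1 - a * z"
    have "w = (1 - a * x) * (1 - a * y)"
      by (simp add: w_def z_def algebra_simps)
    then have "u * v = a * (a * w)"
      unfolding u v by (metis comm mult.assoc)
    then have "a * w * (a * w) = u * v * w"
      by (metis comm mult.assoc)
    moreover have "u * v * w \<in> I"
      using I uv(3) ideal_inD(7)[OF _ UNIV_I] unfolding reduced_ideal_def by blast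
    ultimately have "a * w \<in> I"
      using I unfolding reduced_ideal_def by metis
    then show ?thesis
      unfolding w_def by blast
  qed
  obtain P where prime: "prime_ideal_in UNIV P" and disj: "P \<inter> ?X = {}"
    by (rule completely_prime_avoiding[OF red \<open>0 \<notin> ?X\<close> _ step]) auto
  then have P: "ideal_in UNIV P"
    unfolding prime_ideal_in_def by blast
  from prime have max: "maximal_ideal_in UNIV P"
    using dim unfolding zero_dimensional_on_def by blast
  have X: "a * (1 - a * x) \<notin> P" for x
    using disj by blast
  have "a \<notin> P"
    using X[of 0] by simp
  then obtain r where "1 - a * r \<in> P"
    using maximal_ideal_in_inverse[OF is_subring_UNIV comm max] by blast
  then show False
    using X ideal_inD(6)[OF P UNIV_I] by blast
qed

theorem theorem4p12:
  assumes "reduced_ring TYPE('a::ring_1)"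
    and "integral_over (center :: 'a set)"
    and "hilbert_on (center :: 'a set)"
  shows "(has_maximal_subring TYPE('a) \<or>
          (commutative_ring TYPE('a) \<and> hilbert_on (UNIV :: 'a set) \<and>
           (\<exists>f :: 'a \<Rightarrow> nat set set. inj f)))
       \<and> (zero_dimensional_on (center :: 'a set) \<and> \<not> has_maximal_subring TYPE('a)
           \<longrightarrow> commutative_ring TYPE('a) \<and> von_neumann_regular TYPE('a))"
proof (cases "has_maximal_subring TYPE('a)")
  case False
  have comm: "x * y = y * x" for x y :: 'a
    using commutative_if_no_maximal_subring[OF assms False] .
  \<comment> \<open>Through this equation the hypotheses on the center become statements about the
    ring itself.\<close>
  then have center: "center = (UNIV :: 'a set)"
    unfolding center_def by blast
  have "\<exists>M. maximal_ideal_in UNIV M \<and> x \<notin> M" if "x \<noteq> 0" for x :: 'a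
    using exists_maximal_ideal_avoiding[OF assms that] by blast
  then have "\<exists>f :: 'a \<Rightarrow> nat set set. inj f"
    using cardinality_bound[OF comm False countable_modulo_if_no_maximal_subring[OF center False]] by blast
  moreover have "commutative_ring TYPE('a)"
    using comm unfolding commutative_ring_def by blast
  moreover have "von_neumann_regular TYPE('a)" if "zero_dimensional_on (center :: 'a set)"
    using reduced_zero_dimensional_von_neumann_regular[OF assms(1) comm] that unfolding center .
  ultimately show ?thesis
    using assms(3) center by simp
qed simp

end
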